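(* Let $\dot q=g_0+ug_1$, $u\in\mathbb R$, be a control-affine system on a $4$-dimensional manifold $M$ satisfying $$\dim{\rm span}\bigl(g_1,[g_1,g_0],[g_1,[g_1,g_0]],[g_0,[g_1,g_0]]\bigr)=4 .$$ Then any four-dimensional control-affine system with two-dimensional input having the system $\dot q=g_0+ug_1$ as its reduction is feedback equivalent to the system $$\dot q=g_0+u_1g_1+u_2[g_0,g_1],\qquad u_1,u_2\in\mathbb R.$$
   Context: All objects are $C^\infty$. Control-affine systems $\dot q=f_0+u_1f_1+u_2f_2$ with two-dimensional input are assumed to have $f_0,f_1,f_2$ linearly independent. Two such systems on $M$ are feedback equivalent if one is obtained from the other by $u=\mathcal B(q)\tilde u+\mathcal A(q)$ with $\mathcal B(q)$ an invertible $2\times2$ matrix and $\mathcal A(q)\in\mathbb R^2$, i.e. if they have the same sets of admissible velocities at every point. Reduction. For $\dot q=f_0+u_1f_1+u_2f_2$ on a $4$-dimensional $M$ let $V(q)=\{f_0(q)+u_1f_1(q)+u_2f_2(q)\}$, $D_2={\rm span}(f_1,f_2)$, $D_2^2=D_2+[D_2,D_2]$, $[V,D_2](q)={\rm span}(f_1,f_2,[f_1,f_2],[f_0,f_1],[f_0,f_2])(q)$. On $T^*M$ put $h_i(p,q)=p\cdot f_i(q)$, $\{h_i,h_j\}(p,q)=p\cdot[f_i,f_j](q)$; $\vec h$ is the Hamiltonian vector field of $h$, $\pi:T^*M\to M$ the projection, $\perp$ the annihilator in $T^*M$. On $(D_2)^\perp\setminus(D_2^2)^\perp$ let $\vec X=\vec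 h_0+\frac{\{h_0,h_2\}}{\{h_2,h_1\}}\vec h_1+\frac{\{h_1,h_0\}}{\{h_2,h_1\}}\vec h_2$ and ${\rm Ext}(q)=\{\pi_*\vec X(\lambda):\lambda\in T_q^*M\cap(D_2)^\perp\setminus(D_2^2)^\perp\}\subset V(q)$. If $\dim D_2^2=3$ and $\dim[V,D_2](q)=4$ (at all points), then ${\rm Ext}(q)$ is an affine line, and the control-affine system with scalar input whose set of admissible velocities at $q$ is ${\rm Ext}(q)$ is called the reduction of the system. *)

theory Defs
  imports "HOL-Analysis.Analysis" "HOL-Library.Function_Algebras"
begin

section \<open>Functions as a real vector space\<close>

text \<open>Tangent vectors will be real functionals on functions, so pointwise scaling makes
  the library notions of span, dimension and independence available for them.\<close>

instantiation "fun" :: (type, real_vector) real_vector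
begin

definition scaleR_fun_def: "r *\<^sub>R f = (\<lambda>x. r *\<^sub>R f x)"

instance
  by standard (simp_all add: scaleR_fun_def fun_eq_iff scaleR_add_right scaleR_add_left)

end

lemma scaleR_fun_apply [simp]: "(r *\<^sub>R f) x = r *\<^sub>R f x"
  by (simp add: scaleR_fun_def)

section \<open>Smooth manifolds\<close>

primrec Ck_on :: "nat \<Rightarrow> 'e::real_normed_vector set \<Rightarrow> ('e \<Rightarrow> 'b::real_normed_vector) \<Rightarrow> bool" where
  "Ck_on 0 S f \<longleftrightarrow> continuous_on S f"
| "Ck_on (Suc k) S f \<longleftrightarrow>
     (\<forall>x\<in>S. f differentiable (at x)) \<and> (\<forall>v. Ck_on k S (\<lambda>x. frechet_derivative f (at x) v))"

text \<open>Only meant for open sets.\<close>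

definition smooth_on :: "'e::real_normed_vector set \<Rightarrow> ('e \<Rightarrow> 'b::real_normed_vector) \<Rightarrow> bool" where
  "smooth_on S f \<longleftrightarrow> (\<forall>k. Ck_on k S f)"

text \<open>A chart is a pair of its domain and its coordinate map into the model space; values of
  the coordinate map outside the domain are irrelevant.\<close>

type_synonym ('m, 'e) chart = "'m set \<times> ('m \<Rightarrow> 'e)"
type_synonym ('m, 'e) atlas = "('m, 'e) chart set"

abbreviation chart_inv :: "('m, 'e) chart \<Rightarrow> 'e \<Rightarrow> 'm" where
  "chart_inv c \<equiv> inv_into (fst c) (snd c)"

definition points :: "('m, 'e) atlas \<Rightarrow> 'm set" where
  "points A = (\<Union>c\<in>A. fst c)"

definition smooth_manifold :: "'m topology \<Rightarrow> ('m, 'e::euclidean_space) atlas \<Rightarrow> bool" where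
  "smooth_manifold T A \<longleftrightarrow>
     Hausdorff_space T \<and> second_countable T \<and> points A = topspace T \<and>
     (\<forall>(U, \<phi>)\<in>A. openin T U \<and> open (\<phi> ` U) \<and>
        homeomorphic_map (subtopology T U) (top_of_set (\<phi> ` U)) \<phi>) \<and>
     (\<forall>(U, \<phi>)\<in>A. \<forall>(V, \<psi>)\<in>A. smooth_on (\<phi> ` (U \<inter> V)) (\<psi> \<circ> inv_into U \<phi>))"

text \<open>Smoothness in a neighbourhood of a point.\<close>

definition smooth_at ::
    "('m, 'e::euclidean_space) atlas \<Rightarrow> ('m \<Rightarrow> 'b::real_normed_vector) \<Rightarrow> 'm \<Rightarrow> bool" where
  "smooth_at A f q \<longleftrightarrow>
     (\<forall>c\<in>A. q \<in> fst c \<longrightarrow>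
        (\<exists>W. open W \<and> snd c q \<in> W \<and> W \<subseteq> snd c ` fst c \<and> smooth_on W (f \<circ> chart_inv c)))"

section \<open>Tangent vectors and vector fields\<close>

text \<open>A tangent vector at \<open>q\<close> is a derivation of the algebra of functions that are smooth
  near \<open>q\<close>. It automatically depends on the germ of its argument only (apply the product rule
  to an indicator function of a neighbourhood of \<open>q\<close>). All other arguments
  are sent to zero, so that equal derivations are equal as functions.\<close>

type_synonym 'm tvec = "('m \<Rightarrow> real) \<Rightarrow> real"
type_synonym 'm vfield = "'m \<Rightarrow> 'm tvec"

definition tangent_space :: "('m, 'e::euclidean_space) atlas \<Rightarrow> 'm \<Rightarrow> 'm tvec set" where
  "tangent_space A q = {v.
     (\<forall>f g. smooth_at A f q \<longrightarrow> smooth_at A g q \<longrightarrow>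
        v (\<lambda>x. f x + g x) = v f + v g \<and>
        v (\<lambda>x. f x * g x) = f q * v g + g q * v f) \<and>
     (\<forall>f r. smooth_at A f q \<longrightarrow> v (\<lambda>x. r * f x) = r * v f) \<and>
     (\<forall>f. \<not> smooth_at A f q \<longrightarrow> v f = 0)}"

definition smooth_vf :: "('m, 'e::euclidean_space) atlas \<Rightarrow> 'm vfield \<Rightarrow> bool" where
  "smooth_vf A X \<longleftrightarrow>
     (\<forall>q\<in>points A. X q \<in> tangent_space A q \<and>
        (\<forall>f. smooth_at A f q \<longrightarrow> smooth_at A (\<lambda>x. X x f) q))"

definition lie :: "('m, 'e::euclidean_space) atlas \<Rightarrow> 'm vfield \<Rightarrow> 'm vfield \<Rightarrow> 'm vfield" where
  "lie A X Y q =
     (\<lambda>f. if smooth_at A f q then X q (\<lambda>x. Y x f) - Y q (\<lambda>x. X x f) else 0)"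

definition coord_vec :: "('m, 'e::euclidean_space) atlas \<Rightarrow> ('m, 'e) chart \<Rightarrow> 'e \<Rightarrow> 'm vfield" where
  "coord_vec A c e q =
     (\<lambda>f. if smooth_at A f q then frechet_derivative (f \<circ> chart_inv c) (at (snd c q)) e else 0)"

definition pushforward ::
    "('m, 'e::euclidean_space) atlas \<Rightarrow> ('m \<Rightarrow> 'n) \<Rightarrow> ('n, 'd::euclidean_space) atlas
      \<Rightarrow> 'm \<Rightarrow> 'm tvec \<Rightarrow> 'n tvec" where
  "pushforward A F B x v = (\<lambda>f. if smooth_at B f (F x) then v (f \<circ> F) else 0)"

section \<open>The cotangent bundle\<close>

type_synonym 'm covec = "'m \<times> ('m tvec \<Rightarrow> real)"

definition cotangent_space ::
    "('m, 'e::euclidean_space) atlas \<Rightarrow> 'm \<Rightarrow> ('m tvec \<Rightarrow> real) set" where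
  "cotangent_space A q = {p.
     (\<forall>v\<in>tangent_space A q. \<forall>w\<in>tangent_space A q. p (v + w) = p v + p w) \<and>
     (\<forall>v\<in>tangent_space A q. \<forall>r. p (r *\<^sub>R v) = r * p v) \<and>
     (\<forall>v. v \<notin> tangent_space A q \<longrightarrow> p v = 0)}"

text \<open>A chart \<open>x\<close> of the base induces the canonical coordinates \<open>(x, \<xi>)\<close> on the cotangent bundle,
  where \<open>\<xi>\<close> has the components \<open>p (\<partial>/\<partial>x\<^sub>b)\<close>.\<close>

definition cotangent_chart ::
    "('m, 'e::euclidean_space) atlas \<Rightarrow> ('m, 'e) chart \<Rightarrow> ('m covec, 'e \<times> 'e) chart" where
  "cotangent_chart A c =
     ({(q, p). q \<in> fst c \<and> p \<in> cotangent_space A q},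
      \<lambda>(q, p). (snd c q, \<Sum>b\<in>Basis. p (coord_vec A c b q) *\<^sub>R b))"

definition cotangent_atlas ::
    "('m, 'e::euclidean_space) atlas \<Rightarrow> ('m covec, 'e \<times> 'e) atlas" where
  "cotangent_atlas A = cotangent_chart A ` A"

text \<open>The Hamiltonian vector field
  \<open>\<Sum>\<^sub>b \<partial>h/\<partial>\<xi>\<^sub>b \<partial>/\<partial>x\<^sub>b - \<partial>h/\<partial>x\<^sub>b \<partial>/\<partial>\<xi>\<^sub>b\<close> in canonical coordinates. It does not depend on the
  base chart that is chosen, because changes of canonical coordinates are symplectic.\<close>

definition hamiltonian_vf ::
    "('m, 'e::euclidean_space) atlas \<Rightarrow> ('m covec \<Rightarrow> real) \<Rightarrow> 'm covec vfield" where
  "hamiltonian_vf A h \<mu> =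
     (let B = cotangent_atlas A;
          c = cotangent_chart A (SOME c. c \<in> A \<and> fst \<mu> \<in> fst c)
      in \<Sum>b\<in>Basis. (coord_vec B c (0, b) \<mu> h *\<^sub>R coord_vec B c (b, 0) \<mu>
                  - coord_vec B c (b, 0) \<mu> h *\<^sub>R coord_vec B c (0, b) \<mu>))"

definition lin_ham :: "'m vfield \<Rightarrow> 'm covec \<Rightarrow> real" where
  "lin_ham X = (\<lambda>(q, p). p (X q))"

definition annihilator ::
    "('m, 'e::euclidean_space) atlas \<Rightarrow> ('m \<Rightarrow> 'm tvec set) \<Rightarrow> 'm covec set" where
  "annihilator A D =
     {(q, p). q \<in> points A \<and> p \<in> cotangent_space A q \<and> (\<forall>v\<in>D q. p v = 0)}"

section \<open>Control-affine systems\<close>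

definition control_affine2 ::
    "('m, 'e::euclidean_space) atlas \<Rightarrow> 'm vfield \<Rightarrow> 'm vfield \<Rightarrow> 'm vfield \<Rightarrow> bool" where
  "control_affine2 A f0 f1 f2 \<longleftrightarrow>
     smooth_vf A f0 \<and> smooth_vf A f1 \<and> smooth_vf A f2 \<and>
     (\<forall>q\<in>points A. distinct [f0 q, f1 q, f2 q] \<and> independent {f0 q, f1 q, f2 q})"

definition feedback_equivalent ::
    "('m, 'e::euclidean_space) atlas \<Rightarrow> 'm vfield \<Rightarrow> 'm vfield \<Rightarrow> 'm vfield
      \<Rightarrow> 'm vfield \<Rightarrow> 'm vfield \<Rightarrow> 'm vfield \<Rightarrow> bool" where
  "feedback_equivalent A f0 f1 f2 k0 k1 k2 \<longleftrightarrow>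
     control_affine2 A f0 f1 f2 \<and> control_affine2 A k0 k1 k2 \<and>
     (\<exists>(\<B> :: 'm \<Rightarrow> real^2^2) (\<A> :: 'm \<Rightarrow> real^2).
        \<forall>q\<in>points A.
          smooth_at A \<B> q \<and> smooth_at A \<A> q \<and> invertible (\<B> q) \<and>
          (\<forall>w. let u = \<B> q *v w + \<A> q in
             f0 q + (u $ 1) *\<^sub>R f1 q + (u $ 2) *\<^sub>R f2 q
             = k0 q + (w $ 1) *\<^sub>R k1 q + (w $ 2) *\<^sub>R k2 q))"

definition admissible1 :: "'m vfield \<Rightarrow> 'm vfield \<Rightarrow> 'm \<Rightarrow> 'm tvec set" where
  "admissible1 g0 g1 q = {g0 q + u *\<^sub>R g1 q | u. True}"

definition distribution2 :: "'m vfield \<Rightarrow> 'm vfield \<Rightarrow> 'm \<Rightarrow> 'm tvec set" where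
  "distribution2 f1 f2 q = span {f1 q, f2 q}"

definition distribution_square ::
    "('m, 'e::euclidean_space) atlas \<Rightarrow> ('m \<Rightarrow> 'm tvec set) \<Rightarrow> 'm \<Rightarrow> 'm tvec set" where
  "distribution_square A D q =
     span (D q \<union> {lie A X Y q | X Y. smooth_vf A X \<and> smooth_vf A Y \<and>
                                  (\<forall>x\<in>points A. X x \<in> D x \<and> Y x \<in> D x)})"

definition ext_field ::
    "('m, 'e::euclidean_space) atlas \<Rightarrow> 'm vfield \<Rightarrow> 'm vfield \<Rightarrow> 'm vfield
      \<Rightarrow> 'm covec vfield" where
  "ext_field A f0 f1 f2 \<mu> =
     (let h = (\<lambda>f. hamiltonian_vf A (lin_ham f) \<mu>);
          br = (\<lambda>f f'. lin_ham (lie A f f') \<mu>)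
      in h f0 + (br f0 f2 / br f2 f1) *\<^sub>R h f1 + (br f1 f0 / br f2 f1) *\<^sub>R h f2)"

definition Ext ::
    "('m, 'e::euclidean_space) atlas \<Rightarrow> 'm vfield \<Rightarrow> 'm vfield \<Rightarrow> 'm vfield
      \<Rightarrow> 'm \<Rightarrow> 'm tvec set" where
  "Ext A f0 f1 f2 q =
     (let D = distribution2 f1 f2
      in {pushforward (cotangent_atlas A) fst A \<mu> (ext_field A f0 f1 f2 \<mu>) | \<mu>.
            fst \<mu> = q \<and> \<mu> \<in> annihilator A D - annihilator A (distribution_square A D)})"

definition is_reduction ::
    "('m, 'e::euclidean_space) atlas \<Rightarrow> 'm vfield \<Rightarrow> 'm vfield \<Rightarrow> 'm vfield
      \<Rightarrow> 'm vfield \<Rightarrow> 'm vfield \<Rightarrow> bool" where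
  "is_reduction A f0 f1 f2 g0 g1 \<longleftrightarrow>
     (\<forall>q\<in>points A.
        dim (distribution_square A (distribution2 f1 f2) q) = 3 \<and>
        dim (span {f1 q, f2 q, lie A f1 f2 q, lie A f0 f1 q, lie A f0 f2 q}) = 4 \<and>
        Ext A f0 f1 f2 q = admissible1 g0 g1 q)"

end

theory Submission
  imports Defs
begin

text \<open>
  Hadamard's lemma shows that derivations are combinations of coordinate derivations, so the
  covectors at a point are described by \<open>dim M\<close> coordinates and the Hamiltonian vector field of
  \<open>p \<mapsto> p (X q)\<close> projects to \<open>X\<close>. Hence every \<open>v \<in> Ext q\<close> is \<open>f\<^sub>0 + a f\<^sub>1 + b f\<^sub>2\<close> at \<open>q\<close>, where
  some \<open>p\<close> with \<open>p f\<^sub>1 = p f\<^sub>2 = 0\<close> and \<open>p [f\<^sub>1, f\<^sub>2] \<noteq> 0\<close> satisfies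
  \<open>p [f\<^sub>0 + a f\<^sub>1 + b f\<^sub>2, f\<^sub>i] = 0\<close> for constant \<open>a, b\<close>. If \<open>Ext\<close> is the line \<open>g\<^sub>0 + u g\<^sub>1\<close>, then
  \<open>g\<^sub>0 - f\<^sub>0\<close> and \<open>g\<^sub>1\<close> are smooth combinations of \<open>f\<^sub>1, f\<^sub>2\<close>, and the covectors belonging to
  \<open>u = 0\<close> and \<open>u = 1\<close> both annihilate \<open>f\<^sub>1\<close>, \<open>f\<^sub>2\<close> and \<open>[g\<^sub>0, g\<^sub>1]\<close>. They are not proportional because
  \<open>g\<^sub>1 \<noteq> 0\<close>, so in dimension four \<open>[g\<^sub>0, g\<^sub>1]\<close> lies in the span of \<open>f\<^sub>1, f\<^sub>2\<close>; being independent
  of \<open>g\<^sub>1\<close>, it completes \<open>g\<^sub>1\<close> to a frame of that distribution.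
\<close>

section \<open>Calculus of smooth maps\<close>

lemma Ck_on_mono: "Ck_on k S f \<Longrightarrow> T \<subseteq> S \<Longrightarrow> Ck_on k T f"
  by (induction k arbitrary: f) (auto intro: continuous_on_subset)

lemma Ck_on_SucD: "Ck_on (Suc k) S f \<Longrightarrow> Ck_on k S f"
proof (induction k arbitrary: f)
  case 0
  then show ?case
    by (auto intro!: continuous_at_imp_continuous_on differentiable_imp_continuous_within)
qed auto

text \<open>Since \<open>S\<close> is open, equality on \<open>S\<close> is equality near each of
  its points. The Frechet derivatives then coincide on \<open>S\<close> too, and the induction can
  pass to them.\<close>

lemma Ck_on_cong:
  assumes "open S" "\<And>x. x \<in> S \<Longrightarrow> f x = g x" "Ck_on k S f"
  shows "Ck_on k S g"
  using assms(2,3)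
proof (induction k arbitrary: f g)
  case 0
  then show ?case by (auto cong: continuous_on_cong)
next
  case (Suc k)
  have d: "(g has_derivative frechet_derivative f (at x)) (at x)" if "x \<in> S" for x
    using Suc.prems that assms(1)
    by (auto simp: frechet_derivative_works intro: has_derivative_transform_within_open)
  then have e: "frechet_derivative f (at x) = frechet_derivative g (at x)" if "x \<in> S" for x
    using that frechet_derivative_at by blast
  have "Ck_on k S (\<lambda>x. frechet_derivative f (at x) v)" for v
    using Suc.prems(2) by simp
  from Suc.IH[OF fun_cong[OF e] this] have "Ck_on k S (\<lambda>x. frechet_derivative g (at x) v)" for v .
  then show ?case unfolding Ck_on.simps differentiable_def using d by blast
qed

text \<open>Together with \<open>Ck_on_SucE\<close> this trades \<open>frechet_derivative\<close>
  for an arbitrary family of derivatives, so that the rules for \<open>has_derivative\<close> can be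
  used in inductions on \<open>k\<close>.\<close>

lemma Ck_on_SucI:
  assumes "open S" "\<And>x. x \<in> S \<Longrightarrow> (f has_derivative f' x) (at x)"
    "\<And>v. Ck_on k S (\<lambda>x. f' x v)"
  shows "Ck_on (Suc k) S f"
proof -
  have "f' x = frechet_derivative f (at x)" if "x \<in> S" for x
    using assms(2)[OF that] by (rule frechet_derivative_at)
  then have "Ck_on k S (\<lambda>x. frechet_derivative f (at x) v)" for v
    by (intro Ck_on_cong[OF assms(1) _ assms(3)[of v]]) simp
  then show ?thesis
    using assms(2) by (auto simp: differentiable_def)
qed

lemma Ck_on_SucE:
  assumes "Ck_on (Suc k) S f"
  obtains f' where "\<And>x. x \<in> S \<Longrightarrow> (f has_derivative f' x) (at x)"
    "\<And>v. Ck_on k S (\<lambda>x. f' x v)"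
  using assms by (intro that[of "\<lambda>x. frechet_derivative f (at x)"]) (auto simp: frechet_derivative_works)

lemma Ck_on_const: "open S \<Longrightarrow> Ck_on k S (\<lambda>x. c)"
proof (induction k arbitrary: c)
  case (Suc k)
  then show ?case by (intro Ck_on_SucI[where f'="\<lambda>_ _. 0"]) auto
qed auto

lemma Ck_on_add:
  "open S \<Longrightarrow> Ck_on k S f \<Longrightarrow> Ck_on k S g \<Longrightarrow> Ck_on k S (\<lambda>x. f x + g x)"
proof (induction k arbitrary: f g)
  case (Suc k)
  obtain f' where "\<And>x. x \<in> S \<Longrightarrow> (f has_derivative f' x) (at x)" "\<And>v. Ck_on k S (\<lambda>x. f' x v)"
    using Ck_on_SucE[OF Suc.prems(2)] by metis
  moreover obtain g' where "\<And>x. x \<in> S \<Longrightarrow> (g has_derivative g' x) (at x)" "\<And>v. Ck_on k S (\<lambda>x. g' x v)"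
    using Ck_on_SucE[OF Suc.prems(3)] by metis
  ultimately show ?case
    using Suc by (intro Ck_on_SucI[where f'="\<lambda>x v. f' x v + g' x v"])
      (auto intro: has_derivative_add)
qed (auto intro: continuous_on_add)

lemma Ck_on_sum:
  "open S \<Longrightarrow> (\<And>i. i \<in> I \<Longrightarrow> Ck_on k S (f i)) \<Longrightarrow> Ck_on k S (\<lambda>x. \<Sum>i\<in>I. f i x)"
  by (induction I rule: infinite_finite_induct) (auto intro: Ck_on_const Ck_on_add)

lemma Ck_on_linear:
  assumes "open S" "bounded_linear h"
  shows "Ck_on k S h"
proof (cases k)
  case 0
  then show ?thesis using assms(2) by (simp add: linear_continuous_on)
next
  case (Suc j)
  then show ?thesis
    using assms by (auto intro!: Ck_on_SucI[where f'="\<lambda>_. h"] Ck_on_const bounded_linear_imp_has_derivative simp del: Ck_on.simps)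
qed

lemma Ck_on_scaleR:
  "open S \<Longrightarrow> Ck_on k S f \<Longrightarrow> Ck_on k S g \<Longrightarrow> Ck_on k S (\<lambda>x. f x *\<^sub>R g x)"
proof (induction k arbitrary: f g)
  case (Suc k)
  have fg: "Ck_on k S f" "Ck_on k S g" using Suc.prems by (auto intro: Ck_on_SucD)
  obtain f' where "\<And>x. x \<in> S \<Longrightarrow> (f has_derivative f' x) (at x)" "\<And>v. Ck_on k S (\<lambda>x. f' x v)"
    using Ck_on_SucE[OF Suc.prems(2)] by metis
  moreover obtain g' where "\<And>x. x \<in> S \<Longrightarrow> (g has_derivative g' x) (at x)" "\<And>v. Ck_on k S (\<lambda>x. g' x v)"
    using Ck_on_SucE[OF Suc.prems(3)] by metis
  ultimately show ?case
    using Suc fg by (intro Ck_on_SucI[where f'="\<lambda>x v. f x *\<^sub>R g' x v + f' x v *\<^sub>R g x"])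
      (auto intro!: has_derivative_scaleR Ck_on_add)
qed (auto intro: continuous_on_scaleR)

text \<open>The derivative of the reciprocal is a product of \<open>f'\<close> with the reciprocal
  itself, which is \<open>Ck_on k\<close> by the induction hypothesis.\<close>

lemma Ck_on_inverse:
  fixes f :: "'e::real_normed_vector \<Rightarrow> real"
  shows "open S \<Longrightarrow> Ck_on k S f \<Longrightarrow> (\<And>x. x \<in> S \<Longrightarrow> f x \<noteq> 0) \<Longrightarrow> Ck_on k S (\<lambda>x. inverse (f x))"
proof (induction k)
  case (Suc k)
  have i: "Ck_on k S (\<lambda>x. inverse (f x))" using Suc.IH Suc.prems Ck_on_SucD[OF Suc.prems(2)] by simp
  obtain f' where f': "\<And>x. x \<in> S \<Longrightarrow> (f has_derivative f' x) (at x)" "\<And>v. Ck_on k S (\<lambda>x. f' x v)"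
    using Ck_on_SucE[OF Suc.prems(2)] by metis
  have "Ck_on k S (\<lambda>x. (-1) *\<^sub>R inverse (f x) *\<^sub>R f' x v *\<^sub>R inverse (f x))" for v
    by (intro Ck_on_scaleR Ck_on_const i f' Suc.prems)
  moreover have "((\<lambda>x. inverse (f x)) has_derivative (\<lambda>v. - (inverse (f x) * f' x v * inverse (f x)))) (at x)"
    if "x \<in> S" for x
    using Suc.prems(3)[OF that] f'(1)[OF that] by (rule Deriv.has_derivative_inverse)
  ultimately show ?case
    using Suc.prems(1) by (intro Ck_on_SucI) (simp_all add: mult.assoc)
qed (auto intro: continuous_on_inverse)

text \<open>In the chain rule \<open>g' (h x)\<close> is applied to the direction
  \<open>h' x v\<close>, which varies with \<open>x\<close>, whereas \<open>Ck_on\<close> controls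
  fixed directions only. Expanding \<open>h' x v\<close> in a basis of the Euclidean space between
  the two maps leaves fixed directions with scalar coefficients.\<close>

lemma Ck_on_compose:
  fixes h :: "'e::real_normed_vector \<Rightarrow> 'd::euclidean_space"
  shows "open S \<Longrightarrow> open U \<Longrightarrow> h ` S \<subseteq> U \<Longrightarrow> Ck_on k S h \<Longrightarrow> Ck_on k U g \<Longrightarrow>
    Ck_on k S (\<lambda>x. g (h x))"
proof (induction k arbitrary: g)
  case 0
  then show ?case by (auto intro: continuous_on_compose2)
next
  case (Suc k)
  have h: "Ck_on k S h" using Suc.prems by (auto intro: Ck_on_SucD)
  obtain h' where h': "\<And>x. x \<in> S \<Longrightarrow> (h has_derivative h' x) (at x)" "\<And>v. Ck_on k S (\<lambda>x. h' x v)"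
    using Ck_on_SucE[OF Suc.prems(4)] by metis
  obtain g' where g': "\<And>x. x \<in> U \<Longrightarrow> (g has_derivative g' x) (at x)" "\<And>v. Ck_on k U (\<lambda>x. g' x v)"
    using Ck_on_SucE[OF Suc.prems(5)] by metis
  have e: "g' (h x) (h' x v) = (\<Sum>b\<in>Basis. (h' x v \<bullet> b) *\<^sub>R g' (h x) b)" if "x \<in> S" for x v
  proof -
    have "linear (g' (h x))"
      using g'(1) Suc.prems(3) that by (meson has_derivative_linear image_subset_iff)
    then have "g' (h x) (\<Sum>b\<in>Basis. (h' x v \<bullet> b) *\<^sub>R b) = (\<Sum>b\<in>Basis. (h' x v \<bullet> b) *\<^sub>R g' (h x) b)"
      by (simp add: linear_sum linear_cmul)
    then show ?thesis by (simp add: euclidean_representation)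
  qed
  \<comment> \<open>The components are real valued, while the induction hypothesis concerns the
    codomain of \<open>g\<close>; hence a separate induction.\<close>
  have inner: "Ck_on k S (\<lambda>x. h' x v \<bullet> b)" for v b
  proof -
    have "Ck_on k S (\<lambda>x. u x \<bullet> b)" if "Ck_on k S u" for u :: "'e \<Rightarrow> 'd"
      using that
    proof (induction k arbitrary: u)
      case (Suc k)
      obtain u' where u': "\<And>x. x \<in> S \<Longrightarrow> (u has_derivative u' x) (at x)" "\<And>v. Ck_on k S (\<lambda>x. u' x v)"
        using Ck_on_SucE[OF Suc.prems] by metis
      then show ?case using Suc.IH \<open>open S\<close>
        by (intro Ck_on_SucI[where f'="\<lambda>x v. u' x v \<bullet> b"]) (auto intro: has_derivative_inner_left)
    qed (auto intro: continuous_intros)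
    then show ?thesis using h'(2) .
  qed
  have "Ck_on k S (\<lambda>x. \<Sum>b\<in>Basis. (h' x v \<bullet> b) *\<^sub>R g' (h x) b)" for v
    by (intro Ck_on_sum Ck_on_scaleR inner Suc.IH g' h Suc.prems)
  then have "Ck_on k S (\<lambda>x. g' (h x) (h' x v))" for v
    using e Suc.prems(1) by (auto intro: Ck_on_cong)
  moreover have "((\<lambda>x. g (h x)) has_derivative (\<lambda>v. g' (h x) (h' x v))) (at x)" if "x \<in> S" for x
    using has_derivative_compose[OF h'(1)[OF that] g'(1)] Suc.prems(3) that by auto
  ultimately show ?case
    using Suc.prems(1) by (intro Ck_on_SucI) auto
qed

section \<open>Smoothness near a point of the model space\<close>

definition smooth_near :: "('e::real_normed_vector \<Rightarrow> 'b::real_normed_vector) \<Rightarrow> 'e \<Rightarrow> bool" where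
  "smooth_near f a \<longleftrightarrow> (\<exists>W. open W \<and> a \<in> W \<and> smooth_on W f)"

lemma smooth_on_mono: "smooth_on S f \<Longrightarrow> U \<subseteq> S \<Longrightarrow> smooth_on U f"
  by (auto simp: smooth_on_def intro: Ck_on_mono)

lemma smooth_on_cong:
  "open S \<Longrightarrow> (\<And>x. x \<in> S \<Longrightarrow> f x = g x) \<Longrightarrow> smooth_on S f \<Longrightarrow> smooth_on S g"
  unfolding smooth_on_def using Ck_on_cong by blast

lemma smooth_nearE:
  assumes "smooth_near f a" "open U" "a \<in> U"
  obtains W where "open W" "a \<in> W" "W \<subseteq> U" "smooth_on W f"
proof -
  obtain V where V: "open V" "a \<in> V" "smooth_on V f"
    using assms(1) by (auto simp: smooth_near_def)
  show thesis
    using assms V that[of "U \<inter> V"] smooth_on_mono[OF V(3)] by auto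
qed

lemma smooth_near2E:
  assumes "smooth_near f a" "smooth_near g a"
  obtains W where "open W" "a \<in> W" "smooth_on W f" "smooth_on W g"
proof -
  obtain U where U: "open U" "a \<in> U" "smooth_on U f"
    using assms(1) by (auto simp: smooth_near_def)
  obtain W where W: "open W" "a \<in> W" "W \<subseteq> U" "smooth_on W g"
    using assms(2) U(1,2) by (rule smooth_nearE)
  show thesis using that[OF W(1,2) smooth_on_mono[OF U(3) W(3)] W(4)] .
qed

lemma smooth_near_add:
  "smooth_near f a \<Longrightarrow> smooth_near g a \<Longrightarrow> smooth_near (\<lambda>x. f x + g x) a"
proof -
  assume "smooth_near f a" "smooth_near g a"
  then obtain W where "open W" "a \<in> W" "smooth_on W f" "smooth_on W g"
    by (rule smooth_near2E)
  then show "smooth_near (\<lambda>x. f x + g x) a"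
    unfolding smooth_near_def smooth_on_def by (blast intro: Ck_on_add)
qed

lemma smooth_near_scaleR:
  "smooth_near f a \<Longrightarrow> smooth_near g a \<Longrightarrow> smooth_near (\<lambda>x. f x *\<^sub>R g x) a"
proof -
  assume "smooth_near f a" "smooth_near g a"
  then obtain W where "open W" "a \<in> W" "smooth_on W f" "smooth_on W g"
    by (rule smooth_near2E)
  then show "smooth_near (\<lambda>x. f x *\<^sub>R g x) a"
    unfolding smooth_near_def smooth_on_def by (blast intro: Ck_on_scaleR)
qed

lemma smooth_near_const: "smooth_near (\<lambda>x. c) a"
  by (auto simp: smooth_near_def smooth_on_def intro: Ck_on_const)

lemma smooth_near_sum:
  "(\<And>i. i \<in> I \<Longrightarrow> smooth_near (f i) a) \<Longrightarrow> smooth_near (\<lambda>x. \<Sum>i\<in>I. f i x) a"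
  by (induction I rule: infinite_finite_induct) (auto intro: smooth_near_const smooth_near_add)

lemma smooth_near_linear: "bounded_linear h \<Longrightarrow> smooth_near h a"
  by (auto simp: smooth_near_def smooth_on_def intro: Ck_on_linear)

lemma smooth_near_isCont: "smooth_near f a \<Longrightarrow> isCont f a"
  by (metis Ck_on.simps(1) continuous_on_eq_continuous_at smooth_near_def smooth_on_def)

lemma smooth_near_differentiable: "smooth_near f a \<Longrightarrow> f differentiable (at a)"
  by (metis Ck_on.simps(2) smooth_near_def smooth_on_def)

lemma smooth_near_has_derivative:
  "smooth_near f a \<Longrightarrow> (f has_derivative frechet_derivative f (at a)) (at a)"
  using smooth_near_differentiable frechet_derivative_works by blast

lemma smooth_near_eventually:
  "smooth_near f a \<Longrightarrow> eventually (smooth_near f) (nhds a)"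
  unfolding eventually_nhds smooth_near_def by blast

lemma smooth_near_cong:
  assumes "eventually (\<lambda>x. f x = g x) (nhds a)" "smooth_near f a"
  shows "smooth_near g a"
proof -
  obtain U where U: "open U" "a \<in> U" "\<forall>x\<in>U. f x = g x"
    using assms(1) by (auto simp: eventually_nhds)
  obtain W where "open W" "a \<in> W" "W \<subseteq> U" "smooth_on W f"
    using assms(2) U(1,2) by (rule smooth_nearE)
  with U(3) show ?thesis
    unfolding smooth_near_def by (metis smooth_on_cong subsetD)
qed

lemma smooth_near_inverse:
  fixes f :: "'e::real_normed_vector \<Rightarrow> real"
  assumes "smooth_near f a" "f a \<noteq> 0"
  shows "smooth_near (\<lambda>x. inverse (f x)) a"
proof -
  have "eventually (\<lambda>x. f x \<noteq> 0) (nhds a)"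
    using smooth_near_isCont[OF assms(1)] assms(2)
    by (intro tendsto_imp_eventually_ne[where c="f a"]) (simp_all add: isCont_def tendsto_at_iff_tendsto_nhds)
  then obtain U where U: "open U" "a \<in> U" "\<forall>x\<in>U. f x \<noteq> 0"
    by (auto simp: eventually_nhds)
  obtain W where "open W" "a \<in> W" "W \<subseteq> U" "smooth_on W f"
    using assms(1) U(1,2) by (rule smooth_nearE)
  with U(3) show ?thesis
    by (auto simp: smooth_near_def smooth_on_def intro!: Ck_on_inverse exI[of _ W])
qed

lemma smooth_near_compose:
  fixes h :: "'e::real_normed_vector \<Rightarrow> 'd::euclidean_space"
  assumes "smooth_near h a" "smooth_near g (h a)"
  shows "smooth_near (\<lambda>x. g (h x)) a"
proof -
  obtain V where V: "open V" "h a \<in> V" "smooth_on V g"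
    using assms(2) by (auto simp: smooth_near_def)
  obtain W where W: "open W" "a \<in> W" "smooth_on W h"
    using assms(1) by (auto simp: smooth_near_def)
  have "continuous_on W h" using W(3) by (metis Ck_on.simps(1) smooth_on_def)
  then have o: "open (W \<inter> h -` V)"
    using W(1) V(1) by (metis continuous_on_open_vimage inf_commute)
  have "smooth_on (W \<inter> h -` V) h" using W(3) by (auto intro: smooth_on_mono)
  then have "smooth_on (W \<inter> h -` V) (\<lambda>x. g (h x))"
    using V(1,3) o unfolding smooth_on_def by (auto intro: Ck_on_compose[where U=V])
  with o W(2) V(2) show ?thesis unfolding smooth_near_def by blast
qed

text \<open>Regularity of the coefficients in Hadamard's lemma. Differentiating under the integral
  in direction \<open>v\<close> replaces \<open>f\<close> by its derivative along \<open>v\<close>,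
  and the inner map contributes a factor \<open>t\<close>. The general exponent \<open>m\<close>
  makes the claim stable under this step.\<close>

lemma Ck_on_segment_integral:
  fixes f :: "'e::euclidean_space \<Rightarrow> real"
  assumes "smooth_on (ball a r) f"
  shows "Ck_on k (ball a r) (\<lambda>x. integral {0..1} (\<lambda>t. t ^ m * f (a + t *\<^sub>R (x - a))))"
  using assms
proof (induction k arbitrary: f m)
  let ?B = "ball a r" and ?p = "\<lambda>x t. a + t *\<^sub>R (x - a)"
  have p: "?p x t \<in> ?B" if "x \<in> ?B" "t \<in> {0..1}" for x and t :: real
  proof -
    have "norm (t *\<^sub>R (x - a)) \<le> 1 * norm (x - a)"
      using that unfolding norm_scaleR by (intro mult_right_mono) auto
    then show ?thesis using that by (simp add: dist_norm norm_minus_commute)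
  qed
  have cont: "continuous_on (?B \<times> {0..1}) (\<lambda>(x, t). t ^ m * g (?p x t))"
    if "continuous_on ?B g" for g :: "'e \<Rightarrow> real" and m
  proof -
    have "continuous_on (?B \<times> {0..1}) (\<lambda>z. g (?p (fst z) (snd z)))"
      using that by (rule continuous_on_compose2) (use p in \<open>auto intro!: continuous_intros\<close>)
    then show ?thesis
      by (auto simp: case_prod_unfold intro!: continuous_intros)
  qed
  {
    case 0
    then have "continuous_on ?B f" unfolding smooth_on_def using Ck_on.simps(1) by blast
    from integral_continuous_on_param[of ?B 0 1 "\<lambda>x t. t ^ m * f (?p x t)"] cont[OF this]
    show ?case by simp
  next
    case (Suc k)
    let ?D = "\<lambda>x. frechet_derivative f (at x)"
    have D: "(f has_derivative ?D x) (at x)" if "x \<in> ?B" for x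
      using Suc.prems that Ck_on.simps(2) unfolding smooth_on_def frechet_derivative_works by blast
    have sD: "smooth_on ?B (\<lambda>x. ?D x v)" for v
      using Suc.prems Ck_on.simps(2) unfolding smooth_on_def by blast
    then have cD: "continuous_on ?B (\<lambda>x. ?D x v)" for v
      unfolding smooth_on_def using Ck_on.simps(1) by blast
    have cf: "continuous_on ?B f"
      using Suc.prems unfolding smooth_on_def using Ck_on.simps(1) by blast
    \<comment> \<open>\<open>leibniz_rule\<close> takes the derivative of the integrand as a jointly
      continuous family of bounded linear maps. In finite dimension its continuity can be checked on
      basis vectors.\<close>
    define L where "L x t = Blinfun (\<lambda>v. t ^ Suc m * ?D (?p x t) v)" for x t
    have L: "blinfun_apply (L x t) v = t ^ Suc m * ?D (?p x t) v" if "x \<in> ?B" "t \<in> {0..1}" for x t v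
    proof -
      have "bounded_linear (\<lambda>v. t ^ Suc m * ?D (?p x t) v)"
        using D[OF p[OF that]] by (intro bounded_linear_const_mult has_derivative_bounded_linear)
      then show ?thesis unfolding L_def by (simp add: bounded_linear_Blinfun_apply)
    qed
    have cL: "continuous_on (?B \<times> {0..1}) (\<lambda>(x, t). L x t)"
    proof (rule continuous_on_blinfun_componentwise)
      fix i :: 'e
      have "continuous_on (?B \<times> {0..1}) (\<lambda>(x, t). t ^ Suc m * ?D (?p x t) i)"
        using cont[OF cD] .
      then show "continuous_on (?B \<times> {0..1}) (\<lambda>z. blinfun_apply (case z of (x, t) \<Rightarrow> L x t) i)"
        by (rule continuous_on_eq) (auto simp: L)
    qed
    have der: "((\<lambda>x. integral {0..1} (\<lambda>t. t ^ m * f (?p x t))) has_derivative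
        (\<lambda>v. integral {0..1} (\<lambda>t. t ^ Suc m * ?D (?p x t) v))) (at x)" if x: "x \<in> ?B" for x
    proof -
      have "((\<lambda>x. integral (cbox 0 1) (\<lambda>t. t ^ m * f (?p x t))) has_derivative
          blinfun_apply (integral (cbox 0 1) (L x))) (at x within ?B)"
      proof (rule leibniz_rule)
        fix y and t :: real assume yt: "y \<in> ?B" "t \<in> cbox 0 1"
        have "((\<lambda>x. ?p x t) has_derivative (\<lambda>v. t *\<^sub>R v)) (at y)"
          by (auto intro!: derivative_eq_intros)
        from has_derivative_compose[OF this D[OF p]] yt
        have "((\<lambda>x. f (?p x t)) has_derivative (\<lambda>v. ?D (?p y t) (t *\<^sub>R v))) (at y)" by auto
        then have "((\<lambda>x. t ^ m * f (?p x t)) has_derivative (\<lambda>v. t ^ m * ?D (?p y t) (t *\<^sub>R v))) (at y)"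
          by (rule has_derivative_mult_right)
        moreover have "(\<lambda>v. t ^ m * ?D (?p y t) (t *\<^sub>R v)) = blinfun_apply (L y t)"
        proof
          fix v
          have "?D (?p y t) (t *\<^sub>R v) = t * ?D (?p y t) v"
            using has_derivative_linear[OF D[OF p]] yt by (auto simp: linear_cmul)
          then show "t ^ m * ?D (?p y t) (t *\<^sub>R v) = blinfun_apply (L y t) v"
            using yt by (simp add: L)
        qed
        ultimately show "((\<lambda>x. t ^ m * f (?p x t)) has_derivative blinfun_apply (L y t)) (at y within ?B)"
          by (simp add: has_derivative_at_withinI)
      next
        fix y assume y: "y \<in> ?B"
        have "continuous_on {0..1} (\<lambda>t. f (?p y t))"
          using cf by (rule continuous_on_compose2) (use p y in \<open>auto intro!: continuous_intros\<close>)
        then show "(\<lambda>t. t ^ m * f (?p y t)) integrable_on cbox 0 1"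
          by (intro integrable_continuous) (auto intro!: continuous_intros)
      qed (use cL x in auto)
      moreover have "blinfun_apply (integral (cbox 0 1) (L x)) v =
          integral {0..1} (\<lambda>t. t ^ Suc m * ?D (?p x t) v)" for v
      proof -
        have "continuous_on {0..1} (\<lambda>t. case (x, t) of (x, t) \<Rightarrow> L x t)"
          using cL by (rule continuous_on_compose2) (use x in \<open>auto intro!: continuous_intros\<close>)
        then have "L x integrable_on cbox 0 1"
          by (intro integrable_continuous) auto
        then have "blinfun_apply (integral (cbox 0 1) (L x)) v = integral {0..1} (\<lambda>t. blinfun_apply (L x t) v)"
          by (simp add: blinfun_apply_integral)
        also have "\<dots> = integral {0..1} (\<lambda>t. t ^ Suc m * ?D (?p x t) v)"
          using x by (intro Henstock_Kurzweil_Integration.integral_cong) (simp add: L)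
        finally show ?thesis .
      qed
      ultimately show ?thesis
        using at_within_open[OF x] by (metis (no_types, lifting) ext cbox_interval open_ball)
    qed
    show ?case
      by (rule Ck_on_SucI[OF open_ball der Suc.IH[OF sD]])
  }
qed

text \<open>The increment \<open>f x - f a\<close> is the integral of the derivative along the
  segment from \<open>a\<close> to \<open>x\<close>. Expanding the direction \<open>x - a\<close> in
  the basis gives the coefficients \<open>G b\<close> as segment integrals with exponent 0; at
  \<open>x = a\<close> their integrand is constant.\<close>

lemma Hadamard_expansion:
  fixes f :: "'e::euclidean_space \<Rightarrow> real"
  assumes "smooth_near f a"
  obtains G where "\<And>b. smooth_near (G b) a" "\<And>b. G b a = frechet_derivative f (at a) b"
    "eventually (\<lambda>x. f x = f a + (\<Sum>b\<in>Basis. (x \<bullet> b - a \<bullet> b) * G b x)) (nhds a)"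
proof -
  obtain W where W: "open W" "a \<in> W" "smooth_on W f"
    using assms by (auto simp: smooth_near_def)
  then obtain r where r: "r > 0" "ball a r \<subseteq> W" using open_contains_ball by blast
  let ?B = "ball a r" and ?D = "\<lambda>x. frechet_derivative f (at x)" and ?p = "\<lambda>x t. a + t *\<^sub>R (x - a)"
  have sf: "smooth_on ?B f" using W(3) r(2) by (rule smooth_on_mono)
  have D: "(f has_derivative ?D x) (at x)" if "x \<in> ?B" for x
    using sf that Ck_on.simps(2) unfolding smooth_on_def frechet_derivative_works by blast
  have sD: "smooth_on ?B (\<lambda>x. ?D x v)" for v
    using sf Ck_on.simps(2) unfolding smooth_on_def by blast
  then have cD: "continuous_on ?B (\<lambda>x. ?D x v)" for v
    unfolding smooth_on_def using Ck_on.simps(1) by blast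
  have p: "?p x t \<in> ?B" if "x \<in> ?B" "t \<in> {0..1}" for x and t :: real
  proof -
    have "norm (t *\<^sub>R (x - a)) \<le> 1 * norm (x - a)"
      using that unfolding norm_scaleR by (intro mult_right_mono) auto
    then show ?thesis using that by (simp add: dist_norm norm_minus_commute)
  qed
  define G where "G b x = integral {0..1} (\<lambda>t. ?D (?p x t) b)" for b x
  have sG: "smooth_near (G b) a" for b
    using Ck_on_segment_integral[OF sD, where m=0] r(1)
    unfolding smooth_near_def smooth_on_def G_def by (intro exI[of _ ?B]) simp
  have Ga: "G b a = ?D a b" for b by (simp add: G_def)
  have "f x = f a + (\<Sum>b\<in>Basis. (x \<bullet> b - a \<bullet> b) * G b x)" if x: "x \<in> ?B" for x
  proof -
    have "((\<lambda>t. ?D (?p x t) (x - a)) has_integral (f (?p x 1) - f (?p x 0))) {0..1}"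
    proof (rule fundamental_theorem_of_calculus)
      fix t :: real assume t: "t \<in> {0..1}"
      have "((\<lambda>t. ?p x t) has_derivative (\<lambda>s. s *\<^sub>R (x - a))) (at t)"
        by (auto intro!: derivative_eq_intros)
      from has_derivative_compose[OF this D[OF p[OF x t]]]
      have "((\<lambda>t. f (?p x t)) has_derivative (\<lambda>s. ?D (?p x t) (s *\<^sub>R (x - a)))) (at t)" .
      moreover have "?D (?p x t) (s *\<^sub>R (x - a)) = s *\<^sub>R ?D (?p x t) (x - a)" for s
        using has_derivative_linear[OF D[OF p[OF x t]]] by (simp add: linear_cmul)
      ultimately show "((\<lambda>t. f (?p x t)) has_vector_derivative ?D (?p x t) (x - a)) (at t within {0..1})"
        by (auto simp: has_vector_derivative_def intro: has_derivative_at_withinI)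
    qed auto
    then have "f x - f a = integral {0..1} (\<lambda>t. ?D (?p x t) (x - a))"
      by (simp add: integral_unique)
    also have "\<dots> = integral {0..1} (\<lambda>t. \<Sum>b\<in>Basis. ((x - a) \<bullet> b) * ?D (?p x t) b)"
    proof (rule Henstock_Kurzweil_Integration.integral_cong)
      fix t :: real assume t: "t \<in> {0..1}"
      have "linear (?D (?p x t))" using has_derivative_linear[OF D[OF p[OF x t]]] .
      then have "?D (?p x t) (\<Sum>b\<in>Basis. ((x - a) \<bullet> b) *\<^sub>R b) = (\<Sum>b\<in>Basis. ((x - a) \<bullet> b) * ?D (?p x t) b)"
        by (simp add: linear_sum linear_cmul)
      then show "?D (?p x t) (x - a) = (\<Sum>b\<in>Basis. ((x - a) \<bullet> b) * ?D (?p x t) b)"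
        by (simp only: euclidean_representation)
    qed
    also have "\<dots> = (\<Sum>b\<in>Basis. integral {0..1} (\<lambda>t. ((x - a) \<bullet> b) * ?D (?p x t) b))"
    proof (rule integral_sum)
      fix b
      have "continuous_on {0..1} (\<lambda>t. ?D (?p x t) b)"
        using cD by (rule continuous_on_compose2) (use p x in \<open>auto intro!: continuous_intros\<close>)
      then show "(\<lambda>t. ((x - a) \<bullet> b) * ?D (?p x t) b) integrable_on {0..1}"
        by (intro integrable_continuous_interval continuous_intros)
    qed simp
    also have "\<dots> = (\<Sum>b\<in>Basis. (x \<bullet> b - a \<bullet> b) * G b x)"
      by (simp add: G_def inner_diff_left)
    finally show ?thesis by simp
  qed
  moreover have "eventually (\<lambda>x. x \<in> ?B) (nhds a)"
    using r(1) by (intro eventually_nhds_in_open) auto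
  ultimately have "eventually (\<lambda>x. f x = f a + (\<Sum>b\<in>Basis. (x \<bullet> b - a \<bullet> b) * G b x)) (nhds a)"
    by (rule eventually_mono[rotated])
  with sG Ga show thesis by (rule that)
qed

lemma has_derivative_cong_nhds:
  assumes "(f has_derivative f') (at a)" "eventually (\<lambda>x. f x = g x) (nhds a)"
  shows "(g has_derivative f') (at a)"
proof -
  obtain W where "open W" "a \<in> W" "\<forall>x\<in>W. f x = g x" using assms(2) by (auto simp: eventually_nhds)
  with assms(1) show ?thesis by (auto intro: has_derivative_transform_within_open)
qed

section \<open>Smooth functions and tangent vectors\<close>

lemma sum_fun_apply: "(\<Sum>i\<in>I. F i) x = (\<Sum>i\<in>I. F i x)"
  for F :: "'i \<Rightarrow> 'a \<Rightarrow> 'b::comm_monoid_add"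
  by (induction I rule: infinite_finite_induct) auto

section \<open>Charts and neighbourhoods on the manifold\<close>

locale smooth_mfd =
  fixes T :: "'m topology" and A :: "('m, 'e::euclidean_space) atlas"
  assumes mfd: "smooth_manifold T A"
begin

lemma topspace_eq: "topspace T = points A"
  using mfd by (simp add: smooth_manifold_def)

lemma points_chart: "c \<in> A \<Longrightarrow> q \<in> fst c \<Longrightarrow> q \<in> points A"
  by (auto simp: points_def)

lemma chart_at:
  assumes "q \<in> points A"
  obtains c where "c \<in> A" "q \<in> fst c"
  using assms by (auto simp: points_def)

lemma chart_props:
  assumes "c \<in> A"
  shows "openin T (fst c)" "open (snd c ` fst c)"
    "homeomorphic_map (subtopology T (fst c)) (top_of_set (snd c ` fst c)) (snd c)"
  using assms mfd unfolding smooth_manifold_def by (fastforce simp: case_prod_unfold)+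

lemma chart_topspace: "c \<in> A \<Longrightarrow> topspace (subtopology T (fst c)) = fst c"
  by (meson chart_props(1) openin_subset topspace_subtopology_subset)

lemma chart_inj: "c \<in> A \<Longrightarrow> inj_on (snd c) (fst c)"
  using homeomorphic_imp_injective_map[OF chart_props(3)] chart_topspace by simp

lemma chart_inv_chart [simp]: "c \<in> A \<Longrightarrow> q \<in> fst c \<Longrightarrow> chart_inv c (snd c q) = q"
  by (simp add: chart_inj)

lemma chart_open_image:
  assumes "c \<in> A" "openin T S"
  shows "open (snd c ` (fst c \<inter> S))"
proof -
  have "openin (subtopology T (fst c)) (fst c \<inter> S)"
    using assms(2) by (auto simp: openin_subtopology)
  then have "openin (top_of_set (snd c ` fst c)) (snd c ` (fst c \<inter> S))"
    using homeomorphic_imp_open_map[OF chart_props(3)[OF assms(1)]]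
    by (simp add: open_map_def)
  then show ?thesis
    using chart_props(2)[OF assms(1)] openin_open_trans by blast
qed

lemma chart_open_vimage:
  assumes "c \<in> A" "open W"
  shows "openin T {x \<in> fst c. snd c x \<in> W}"
proof -
  have "openin (top_of_set (snd c ` fst c)) (snd c ` fst c \<inter> W)"
    using assms(2) by (simp add: openin_open_Int)
  then have "openin (subtopology T (fst c)) {x \<in> topspace (subtopology T (fst c)). snd c x \<in> snd c ` fst c \<inter> W}"
    using homeomorphic_imp_continuous_map[OF chart_props(3)[OF assms(1)]]
      openin_continuous_map_preimage by blast
  then have "openin (subtopology T (fst c)) {x \<in> fst c. snd c x \<in> W}"
    unfolding chart_topspace[OF assms(1)] by (rule back_subst[of "openin _"]) auto
  then show ?thesis
    using chart_props(1)[OF assms(1)] openin_trans_full by blast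
qed

text \<open>A chart is a homeomorphism between open sets, so neighbourhoods of \<open>q\<close>
  correspond to neighbourhoods of its coordinates. Local claims on the manifold thereby become
  claims in the model space.\<close>

lemma eventually_nhdsin_chart:
  assumes "c \<in> A" "q \<in> fst c"
  shows "eventually P (nhdsin T q) \<longleftrightarrow> eventually (\<lambda>y. P (chart_inv c y)) (nhds (snd c q))"
proof
  assume "eventually P (nhdsin T q)"
  then obtain S where S: "openin T S" "q \<in> S" "\<forall>x\<in>S. P x"
    using points_chart[OF assms] by (auto simp: eventually_nhdsin topspace_eq)
  have "open (snd c ` (fst c \<inter> S))" using assms(1) S(1) by (rule chart_open_image)
  moreover have "\<forall>y\<in>snd c ` (fst c \<inter> S). P (chart_inv c y)" using S assms by auto
  ultimately show "eventually (\<lambda>y. P (chart_inv c y)) (nhds (snd c q))"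
    using S(2) assms(2) unfolding eventually_nhds by blast
next
  assume "eventually (\<lambda>y. P (chart_inv c y)) (nhds (snd c q))"
  then obtain W where W: "open W" "snd c q \<in> W" "\<forall>y\<in>W. P (chart_inv c y)"
    by (auto simp: eventually_nhds)
  have "openin T {x \<in> fst c. snd c x \<in> W}" using assms(1) W(1) by (rule chart_open_vimage)
  moreover have "P x" if "x \<in> fst c" "snd c x \<in> W" for x
    using W(3) that chart_inv_chart[OF assms(1) that(1)] by metis
  ultimately show "eventually P (nhdsin T q)"
    using W(2) assms(2) unfolding eventually_nhdsin
    by (intro disjI2 exI[of _ "{x \<in> fst c. snd c x \<in> W}"]) simp
qed

lemma eventually_in_chart: "c \<in> A \<Longrightarrow> q \<in> fst c \<Longrightarrow> eventually (\<lambda>x. x \<in> fst c) (nhdsin T q)"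
  unfolding eventually_nhdsin by (meson chart_props(1))

lemma eventually_points: "eventually (\<lambda>x. x \<in> points A) (nhdsin T q)"
  using openin_topspace[of T] by (auto simp: eventually_nhdsin topspace_eq)

lemma eventually_nhdsin_self: "eventually P (nhdsin T q) \<Longrightarrow> q \<in> points A \<Longrightarrow> P q"
  by (auto simp: eventually_nhdsin topspace_eq)

lemma eventually_chart_inv_right:
  assumes "c \<in> A" "q \<in> fst c"
  shows "eventually (\<lambda>y. chart_inv c y \<in> fst c \<and> snd c (chart_inv c y) = y) (nhds (snd c q))"
proof -
  have "eventually (\<lambda>y. y \<in> snd c ` fst c) (nhds (snd c q))"
    using chart_props(2)[OF assms(1)] assms(2) by (intro eventually_nhds_in_open) auto
  then show ?thesis
    by (rule eventually_mono) (auto simp: f_inv_into_f inv_into_into)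
qed

section \<open>Smooth functions on the manifold\<close>

lemma transition_smooth:
  assumes "c \<in> A" "d \<in> A" "q \<in> fst c" "q \<in> fst d"
  shows "smooth_near (\<lambda>y. snd d (chart_inv c y)) (snd c q)"
proof -
  have "open (snd c ` (fst c \<inter> fst d))"
    using assms(1) chart_props(1)[OF assms(2)] by (rule chart_open_image)
  moreover have "smooth_on (snd c ` (fst c \<inter> fst d)) (snd d \<circ> chart_inv c)"
    using assms(1,2) mfd unfolding smooth_manifold_def by (fastforce simp: case_prod_unfold)
  ultimately show ?thesis
    using assms(3,4) unfolding smooth_near_def by (auto simp: o_def)
qed

text \<open>\<open>smooth_at\<close> quantifies over all charts around \<open>q\<close>; composing
  with the smooth transition maps reduces it to a single one.\<close>

lemma smooth_at_chart:
  assumes "c \<in> A" "q \<in> fst c"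
  shows "smooth_at A f q \<longleftrightarrow> smooth_near (\<lambda>y. f (chart_inv c y)) (snd c q)"
proof
  assume "smooth_at A f q"
  then show "smooth_near (\<lambda>y. f (chart_inv c y)) (snd c q)"
    using assms unfolding smooth_at_def smooth_near_def by (auto simp: o_def)
next
  assume s: "smooth_near (\<lambda>y. f (chart_inv c y)) (snd c q)"
  show "smooth_at A f q"
    unfolding smooth_at_def
  proof (intro ballI impI)
    fix d assume d: "d \<in> A" "q \<in> fst d"
    have composed: "smooth_near (\<lambda>y. f (chart_inv c (snd c (chart_inv d y)))) (snd d q)"
      by (rule smooth_near_compose[OF transition_smooth[OF d(1) assms(1) d(2) assms(2)]])
        (use s d in simp)
    have "eventually (\<lambda>y. chart_inv d y \<in> fst c) (nhds (snd d q))"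
      using eventually_in_chart[OF assms] eventually_nhdsin_chart[OF d] by simp
    then have "eventually (\<lambda>y. f (chart_inv c (snd c (chart_inv d y))) = (f \<circ> chart_inv d) y) (nhds (snd d q))"
      by (rule eventually_mono) (use assms(1) in simp)
    from smooth_near_cong[OF this composed] have "smooth_near (f \<circ> chart_inv d) (snd d q)" .
    moreover have "open (snd d ` fst d)" "snd d q \<in> snd d ` fst d"
      using chart_props(2)[OF d(1)] d(2) by auto
    ultimately obtain W where "open W" "snd d q \<in> W" "W \<subseteq> snd d ` fst d" "smooth_on W (f \<circ> chart_inv d)"
      by (rule smooth_nearE)
    then show "\<exists>W. open W \<and> snd d q \<in> W \<and> W \<subseteq> snd d ` fst d \<and> smooth_on W (f \<circ> chart_inv d)"
      by blast
  qed
qed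

lemma smooth_at_cong:
  assumes "eventually (\<lambda>x. f x = g x) (nhdsin T q)" "q \<in> points A"
  shows "smooth_at A f q \<longleftrightarrow> smooth_at A g q"
proof -
  obtain c where c: "c \<in> A" "q \<in> fst c" using assms(2) by (rule chart_at)
  have "eventually (\<lambda>y. f (chart_inv c y) = g (chart_inv c y)) (nhds (snd c q))"
    using assms(1) eventually_nhdsin_chart[OF c] by simp
  from smooth_near_cong[OF this] smooth_near_cong[OF this[unfolded eq_commute[of "f _"]]]
  show ?thesis
    unfolding smooth_at_chart[OF c] by blast
qed

lemma smooth_at_eventually:
  assumes "smooth_at A f q"
  shows "eventually (smooth_at A f) (nhdsin T q)"
proof (cases "q \<in> points A")
  case True
  then obtain c where c: "c \<in> A" "q \<in> fst c" by (rule chart_at)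
  have "eventually (smooth_near (\<lambda>y. f (chart_inv c y))) (nhds (snd c q))"
    using assms unfolding smooth_at_chart[OF c] by (rule smooth_near_eventually)
  with eventually_chart_inv_right[OF c]
  have "eventually (\<lambda>y. smooth_at A f (chart_inv c y)) (nhds (snd c q))"
    by eventually_elim (metis c(1) smooth_at_chart)
  then show ?thesis using eventually_nhdsin_chart[OF c] by simp
qed (simp add: topspace_eq)

text \<open>No chart contains such a \<open>q\<close>, so smoothness is vacuous there. This lets the
  closure rules below hold at every \<open>q\<close>.\<close>

lemma smooth_at_outside: "q \<notin> points A \<Longrightarrow> smooth_at A f q"
  by (auto simp: smooth_at_def points_def)

lemma smooth_at_const: "smooth_at A (\<lambda>x. k) q"
  by (cases "q \<in> points A") (auto elim!: chart_at simp: smooth_at_chart smooth_near_const smooth_at_outside)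

lemma smooth_at_add: "smooth_at A f q \<Longrightarrow> smooth_at A g q \<Longrightarrow> smooth_at A (\<lambda>x. f x + g x) q"
  by (cases "q \<in> points A") (auto elim!: chart_at simp: smooth_at_chart smooth_at_outside intro: smooth_near_add)

lemma smooth_at_scaleR: "smooth_at A f q \<Longrightarrow> smooth_at A g q \<Longrightarrow> smooth_at A (\<lambda>x. f x *\<^sub>R g x) q"
  by (cases "q \<in> points A") (auto elim!: chart_at simp: smooth_at_chart smooth_at_outside intro: smooth_near_scaleR)

lemma smooth_at_mult: "smooth_at A f q \<Longrightarrow> smooth_at A g q \<Longrightarrow> smooth_at A (\<lambda>x. f x * g x) q"
  for f :: "'m \<Rightarrow> real"
  using smooth_at_scaleR[of f q g] by simp

lemma smooth_at_cmult: "smooth_at A f q \<Longrightarrow> smooth_at A (\<lambda>x. r * f x) q"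
  for f :: "'m \<Rightarrow> real"
  by (intro smooth_at_mult smooth_at_const)

lemma smooth_at_diff: "smooth_at A f q \<Longrightarrow> smooth_at A g q \<Longrightarrow> smooth_at A (\<lambda>x. f x - g x) q"
  using smooth_at_add[of f q "\<lambda>x. (-1) *\<^sub>R g x"] smooth_at_scaleR[OF smooth_at_const, of g q "-1"] by simp

lemma smooth_at_sum:
  "(\<And>i. i \<in> I \<Longrightarrow> smooth_at A (f i) q) \<Longrightarrow> smooth_at A (\<lambda>x. \<Sum>i\<in>I. f i x) q"
  by (induction I rule: infinite_finite_induct) (auto intro: smooth_at_const smooth_at_add)

lemma smooth_at_inverse: "smooth_at A f q \<Longrightarrow> f q \<noteq> 0 \<Longrightarrow> smooth_at A (\<lambda>x. inverse (f x)) q"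
  for f :: "'m \<Rightarrow> real"
proof (cases "q \<in> points A")
  case True
  assume f: "smooth_at A f q" "f q \<noteq> 0"
  obtain c where c: "c \<in> A" "q \<in> fst c" using True by (rule chart_at)
  show ?thesis
    using f unfolding smooth_at_chart[OF c] by (intro smooth_near_inverse) (simp_all add: c)
qed (simp add: smooth_at_outside)

lemma smooth_at_nonzero:
  fixes f :: "'m \<Rightarrow> real"
  assumes "smooth_at A f q" "f q \<noteq> 0"
  shows "eventually (\<lambda>x. f x \<noteq> 0) (nhdsin T q)"
proof (cases "q \<in> points A")
  case True
  then obtain c where c: "c \<in> A" "q \<in> fst c" by (rule chart_at)
  have "isCont (\<lambda>y. f (chart_inv c y)) (snd c q)"
    using assms(1) unfolding smooth_at_chart[OF c] by (rule smooth_near_isCont)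
  then have "((\<lambda>y. f (chart_inv c y)) \<longlongrightarrow> f q) (nhds (snd c q))"
    using tendsto_at_iff_tendsto_nhds[of "\<lambda>y. f (chart_inv c y)" "snd c q"]
    by (simp add: isCont_def c)
  then show ?thesis
    unfolding eventually_nhdsin_chart[OF c] using assms(2) by (rule tendsto_imp_eventually_ne)
qed (simp add: topspace_eq)

text \<open>Carries functions of the coordinates, such as the coefficients of the Hadamard
  expansion, back to the manifold.\<close>

lemma smooth_at_chart_fun:
  assumes "c \<in> A" "q \<in> fst c" "smooth_near g (snd c q)"
  shows "smooth_at A (\<lambda>x. g (snd c x)) q"
  unfolding smooth_at_chart[OF assms(1,2)]
  using eventually_mono[OF eventually_chart_inv_right[OF assms(1,2)]] assms(3)
  by (rule smooth_near_cong) auto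

lemma smooth_at_coord: "c \<in> A \<Longrightarrow> q \<in> fst c \<Longrightarrow> smooth_at A (\<lambda>x. snd c x \<bullet> b) q"
  by (rule smooth_at_chart_fun) (auto intro: smooth_near_linear bounded_linear_inner_left)

text \<open>Near \<open>q\<close> the indicator is constantly 1, however irregular \<open>P\<close>
  may be elsewhere.\<close>

lemma smooth_at_indicator:
  assumes "eventually P (nhdsin T q)" "q \<in> points A"
  shows "smooth_at A (\<lambda>x. if P x then 1 else 0 :: real) q"
proof -
  have e: "eventually (\<lambda>x. (if P x then 1 else 0 :: real) = 1) (nhdsin T q)"
    using assms(1) by (rule eventually_mono) simp
  show ?thesis
    unfolding smooth_at_cong[OF e assms(2)] by (rule smooth_at_const)
qed

section \<open>Derivations at a point\<close>

lemma tan_add: "v \<in> tangent_space A q \<Longrightarrow> smooth_at A f q \<Longrightarrow> smooth_at A g q \<Longrightarrow>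
    v (\<lambda>x. f x + g x) = v f + v g"
  and tan_mult: "v \<in> tangent_space A q \<Longrightarrow> smooth_at A f q \<Longrightarrow> smooth_at A g q \<Longrightarrow>
    v (\<lambda>x. f x * g x) = f q * v g + g q * v f"
  and tan_cmult: "v \<in> tangent_space A q \<Longrightarrow> smooth_at A f q \<Longrightarrow> v (\<lambda>x. r * f x) = r * v f"
  and tan_not_smooth: "v \<in> tangent_space A q \<Longrightarrow> \<not> smooth_at A f q \<Longrightarrow> v f = 0"
  by (auto simp: tangent_space_def)

lemma tangentI:
  assumes "\<And>f g. smooth_at A f q \<Longrightarrow> smooth_at A g q \<Longrightarrow> v (\<lambda>x. f x + g x) = v f + v g"
    "\<And>f g. smooth_at A f q \<Longrightarrow> smooth_at A g q \<Longrightarrow> v (\<lambda>x. f x * g x) = f q * v g + g q * v f"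
    "\<And>f r. smooth_at A f q \<Longrightarrow> v (\<lambda>x. r * f x) = r * v f"
    "\<And>f. \<not> smooth_at A f q \<Longrightarrow> v f = 0"
  shows "v \<in> tangent_space A q"
  using assms by (simp add: tangent_space_def)

lemma tan_diff: "v \<in> tangent_space A q \<Longrightarrow> smooth_at A f q \<Longrightarrow> smooth_at A g q \<Longrightarrow>
    v (\<lambda>x. f x - g x) = v f - v g"
  using tan_add[of v q f "\<lambda>x. (-1) * g x"] tan_cmult[of v q g "-1"] smooth_at_cmult[of g q "-1"] by simp

lemma tan_const:
  assumes "v \<in> tangent_space A q"
  shows "v (\<lambda>x. k) = 0"
proof -
  have "v (\<lambda>x. 1 * 1) = 1 * v (\<lambda>x. 1) + 1 * v (\<lambda>x. 1)"
    using assms by (rule tan_mult) (rule smooth_at_const)+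
  then have "v (\<lambda>x. 1) = 0" by simp
  with tan_cmult[OF assms smooth_at_const, of k 1] show ?thesis by simp
qed

lemma tan_sum:
  assumes "v \<in> tangent_space A q" "\<And>i. i \<in> I \<Longrightarrow> smooth_at A (f i) q"
  shows "v (\<lambda>x. \<Sum>i\<in>I. f i x) = (\<Sum>i\<in>I. v (f i))"
  using assms(2)
proof (induction I rule: infinite_finite_induct)
  case (insert i I)
  then show ?case
    using tan_add[OF assms(1), of "f i" "\<lambda>x. \<Sum>i\<in>I. f i x"] by (simp add: smooth_at_sum)
qed (simp_all add: tan_const[OF assms(1)])

text \<open>Both functions have the same product with the indicator function of the set where they
  agree, and a derivation kills the latter because it is idempotent.\<close>

lemma tan_cong:
  assumes "v \<in> tangent_space A q" "q \<in> points A" "eventually (\<lambda>x. f x = g x) (nhdsin T q)"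
  shows "v f = v g"
proof (cases "smooth_at A f q")
  case True
  then have sg: "smooth_at A g q" using smooth_at_cong[OF assms(3,2)] by simp
  define i where "i x = (if f x = g x then 1 else 0 :: real)" for x
  have s: "smooth_at A i q" unfolding i_def using assms(3,2) by (rule smooth_at_indicator)
  have fg: "f q = g q" using eventually_nhdsin_self[OF assms(3,2)] .
  then have [simp]: "i q = 1" by (simp add: i_def)
  have "(\<lambda>x. i x * i x) = i" by (auto simp: i_def)
  then have [simp]: "v i = 0" using tan_mult[OF assms(1) s s] by simp
  have "(\<lambda>x. i x * f x) = (\<lambda>x. i x * g x)" by (auto simp: i_def)
  then show ?thesis
    using tan_mult[OF assms(1) s True] tan_mult[OF assms(1) s sg] fg by simp
next
  case False
  then have "\<not> smooth_at A g q" using smooth_at_cong[OF assms(3,2)] by simp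
  with False show ?thesis using assms(1) by (simp add: tan_not_smooth)
qed

text \<open>On functions that are not smooth at \<open>q\<close> both sides are 0 by the convention
  in \<open>tangent_space\<close>.\<close>

lemma tangent_ext:
  assumes "v \<in> tangent_space A q" "w \<in> tangent_space A q" "\<And>f. smooth_at A f q \<Longrightarrow> v f = w f"
  shows "v = w"
proof
  fix f show "v f = w f" using assms by (cases "smooth_at A f q") (auto simp: tan_not_smooth)
qed

lemma subspace_tangent: "subspace (tangent_space A q)"
  by (rule subspaceI; rule tangentI)
    (simp_all add: tan_add tan_mult tan_cmult tan_not_smooth algebra_simps)

lemma coord_vec_tangent:
  assumes "c \<in> A" "q \<in> fst c"
  shows "coord_vec A c e q \<in> tangent_space A q"
proof -
  have D: "((\<lambda>y. f (chart_inv c y)) has_derivative frechet_derivative (\<lambda>y. f (chart_inv c y)) (at (snd c q))) (at (snd c q))"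
    if "smooth_at A f q" for f :: "'m \<Rightarrow> real"
    using that unfolding smooth_at_chart[OF assms] by (rule smooth_near_has_derivative)
  note [simp] = coord_vec_def o_def smooth_at_add smooth_at_mult smooth_at_cmult
  show ?thesis
  proof (rule tangentI)
    fix f g :: "'m \<Rightarrow> real" assume f: "smooth_at A f q" and g: "smooth_at A g q"
    show "coord_vec A c e q (\<lambda>x. f x + g x) = coord_vec A c e q f + coord_vec A c e q g"
      using f g frechet_derivative_at[OF has_derivative_add[OF D[OF f] D[OF g]]] by (simp add: fun_eq_iff)
    show "coord_vec A c e q (\<lambda>x. f x * g x) = f q * coord_vec A c e q g + g q * coord_vec A c e q f"
      using f g assms frechet_derivative_at[OF has_derivative_mult[OF D[OF f] D[OF g]]] by (simp add: fun_eq_iff algebra_simps)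
  next
    fix f :: "'m \<Rightarrow> real" and r assume f: "smooth_at A f q"
    show "coord_vec A c e q (\<lambda>x. r * f x) = r * coord_vec A c e q f"
      using f frechet_derivative_at[OF has_derivative_mult_right[OF D[OF f]]] by (simp add: fun_eq_iff)
  qed simp
qed

lemma coord_vec_coord:
  assumes "c \<in> A" "q \<in> fst c"
  shows "coord_vec A c e q (\<lambda>x. snd c x \<bullet> b) = e \<bullet> b"
proof -
  have "((\<lambda>y. y \<bullet> b) has_derivative (\<lambda>y. y \<bullet> b)) (at (snd c q))"
    by (intro bounded_linear_imp_has_derivative bounded_linear_inner_left)
  moreover obtain W where "open W" "snd c q \<in> W" "\<forall>y\<in>W. snd c (chart_inv c y) = y"
    using eventually_chart_inv_right[OF assms] by (auto simp: eventually_nhds)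
  ultimately have "((\<lambda>y. snd c (chart_inv c y) \<bullet> b) has_derivative (\<lambda>y. y \<bullet> b)) (at (snd c q))"
    by (auto intro: has_derivative_transform_within_open)
  then show ?thesis
    using smooth_at_coord[OF assms, of b] by (simp add: frechet_derivative_at[symmetric] coord_vec_def o_def)
qed

text \<open>Apply \<open>v\<close> to the Hadamard expansion of \<open>f\<close> at
  \<open>q\<close>. The constant is killed, and since
  \<open>snd c x \<bullet> b - snd c q \<bullet> b\<close> vanishes at \<open>q\<close>, the product
  rule leaves only \<open>v\<close> of the coordinate times \<open>G b (snd c q)\<close>, which is
  the partial derivative of \<open>f\<close>.\<close>

lemma tangent_expand:
  assumes "c \<in> A" "q \<in> fst c" "v \<in> tangent_space A q"
  shows "v = (\<Sum>b\<in>Basis. v (\<lambda>x. snd c x \<bullet> b) *\<^sub>R coord_vec A c b q)" (is "_ = ?w")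
proof (rule tangent_ext)
  show "?w \<in> tangent_space A q"
    using assms by (intro subspace_sum subspace_scale subspace_tangent coord_vec_tangent)
next
  fix f :: "'m \<Rightarrow> real" assume f: "smooth_at A f q"
  let ?f = "\<lambda>y. f (chart_inv c y)" and ?a = "snd c q"
  have q: "q \<in> points A" using assms(1,2) by (rule points_chart)
  obtain G where G: "\<And>b. smooth_near (G b) ?a" "\<And>b. G b ?a = frechet_derivative ?f (at ?a) b"
    "eventually (\<lambda>y. ?f y = ?f ?a + (\<Sum>b\<in>Basis. (y \<bullet> b - ?a \<bullet> b) * G b y)) (nhds ?a)"
    using f Hadamard_expansion unfolding smooth_at_chart[OF assms(1,2)] by blast
  let ?u = "\<lambda>b x. snd c x \<bullet> b - ?a \<bullet> b"
  have "eventually (\<lambda>y. f (chart_inv c y) = f q + (\<Sum>b\<in>Basis. ?u b (chart_inv c y) * G b (snd c (chart_inv c y)))) (nhds ?a)"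
    using G(3) eventually_chart_inv_right[OF assms(1,2)] by eventually_elim (use assms in simp)
  then have e: "eventually (\<lambda>x. f x = f q + (\<Sum>b\<in>Basis. ?u b x * G b (snd c x))) (nhdsin T q)"
    unfolding eventually_nhdsin_chart[OF assms(1,2)] .
  have u: "smooth_at A (?u b) q" for b
    using assms by (intro smooth_at_diff smooth_at_coord smooth_at_const)
  have g: "smooth_at A (\<lambda>x. G b (snd c x)) q" for b
    using assms(1,2) G(1) by (rule smooth_at_chart_fun)
  have "v f = v (\<lambda>x. f q + (\<Sum>b\<in>Basis. ?u b x * G b (snd c x)))"
    using assms(3) q e by (rule tan_cong)
  also have "\<dots> = v (\<lambda>x. f q) + v (\<lambda>x. \<Sum>b\<in>Basis. ?u b x * G b (snd c x))"
    by (intro tan_add[OF assms(3)] smooth_at_const smooth_at_sum smooth_at_mult u g)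
  also have "\<dots> = (\<Sum>b\<in>Basis. v (\<lambda>x. ?u b x * G b (snd c x)))"
    by (simp add: tan_const[OF assms(3)] tan_sum[OF assms(3)] smooth_at_mult u g)
  also have "\<dots> = (\<Sum>b\<in>Basis. v (?u b) * G b ?a)"
    using tan_mult[OF assms(3) u g] by (simp add: mult.commute)
  also have "\<dots> = (\<Sum>b\<in>Basis. v (\<lambda>x. snd c x \<bullet> b) * coord_vec A c b q f)"
    using tan_diff[OF assms(3) smooth_at_coord[OF assms(1,2)] smooth_at_const] f
    by (simp add: tan_const[OF assms(3)] coord_vec_def o_def G(2))
  also have "\<dots> = ?w f" by (simp add: sum_fun_apply)
  finally show "v f = ?w f" .
qed (rule assms(3))

text \<open>The coordinate derivations generate. The resulting bound on the size of independent sets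
  is how the dimension of the manifold enters the argument.\<close>

lemma finite_tangent_generators:
  assumes "q \<in> points A"
  obtains B where "finite B" "tangent_space A q \<subseteq> span B" "card B \<le> DIM('e)"
proof -
  obtain c where c: "c \<in> A" "q \<in> fst c" using assms by (rule chart_at)
  let ?B = "(\<lambda>b. coord_vec A c b q) ` Basis"
  have "tangent_space A q \<subseteq> span ?B"
  proof
    fix v assume "v \<in> tangent_space A q"
    from tangent_expand[OF c this] show "v \<in> span ?B"
      by (metis (no_types, lifting) image_eqI span_base span_scale span_sum)
  qed
  then show thesis using that[of ?B] card_image_le[of Basis] by auto
qed

section \<open>Vector fields and Lie brackets\<close>

lemma vf_tangent: "smooth_vf A X \<Longrightarrow> q \<in> points A \<Longrightarrow> X q \<in> tangent_space A q"
  and vf_smooth: "smooth_vf A X \<Longrightarrow> q \<in> points A \<Longrightarrow> smooth_at A f q \<Longrightarrow> smooth_at A (\<lambda>x. X x f) q"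
  by (auto simp: smooth_vf_def)

text \<open>The rules for a derivation \<open>Y x\<close> require smoothness at \<open>x\<close>.
  Smoothness at \<open>q\<close> spreads to a neighbourhood, so they become identities of germs that
  \<open>tan_cong\<close> can differentiate.\<close>

lemma vf_eventually:
  assumes "smooth_at A f q" "smooth_at A g q"
    "\<And>x. x \<in> points A \<Longrightarrow> smooth_at A f x \<Longrightarrow> smooth_at A g x \<Longrightarrow> P x"
  shows "eventually P (nhdsin T q)"
  using smooth_at_eventually[OF assms(1)] smooth_at_eventually[OF assms(2)] eventually_points
  by eventually_elim (rule assms(3))

lemma lie_apply: "smooth_at A f q \<Longrightarrow> lie A X Y q f = X q (\<lambda>x. Y x f) - Y q (\<lambda>x. X x f)"
  by (simp add: lie_def)

text \<open>In the product rule for second derivatives the mixed terms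
  \<open>Y q g * X q f + Y q f * X q g\<close> are symmetric in \<open>X\<close> and
  \<open>Y\<close>. They cancel in the bracket, which is why the bracket is again a
  derivation.\<close>

lemma
  assumes "smooth_vf A X" "smooth_vf A Y" "q \<in> points A" "smooth_at A f q" "smooth_at A g q"
  shows vf_vf_add: "X q (\<lambda>x. Y x (\<lambda>y. f y + g y)) = X q (\<lambda>x. Y x f) + X q (\<lambda>x. Y x g)"
    and vf_vf_mult: "X q (\<lambda>x. Y x (\<lambda>y. f y * g y)) =
      f q * X q (\<lambda>x. Y x g) + Y q g * X q f + (g q * X q (\<lambda>x. Y x f) + Y q f * X q g)"
proof -
  note t = vf_tangent[OF assms(1,3)]
  note s = vf_smooth[OF assms(2,3,4)] vf_smooth[OF assms(2,3,5)]
  have "eventually (\<lambda>x. Y x (\<lambda>y. f y + g y) = Y x f + Y x g) (nhdsin T q)"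
    using assms(4,5) by (rule vf_eventually) (rule tan_add[OF vf_tangent[OF assms(2)]])
  from tan_cong[OF t assms(3) this] tan_add[OF t s]
  show "X q (\<lambda>x. Y x (\<lambda>y. f y + g y)) = X q (\<lambda>x. Y x f) + X q (\<lambda>x. Y x g)" by simp
  have "eventually (\<lambda>x. Y x (\<lambda>y. f y * g y) = f x * Y x g + g x * Y x f) (nhdsin T q)"
    using assms(4,5) by (rule vf_eventually) (rule tan_mult[OF vf_tangent[OF assms(2)]])
  from tan_cong[OF t assms(3) this]
    tan_add[OF t smooth_at_mult[OF assms(4) s(2)] smooth_at_mult[OF assms(5) s(1)]]
    tan_mult[OF t assms(4) s(2)] tan_mult[OF t assms(5) s(1)]
  show "X q (\<lambda>x. Y x (\<lambda>y. f y * g y)) =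
      f q * X q (\<lambda>x. Y x g) + Y q g * X q f + (g q * X q (\<lambda>x. Y x f) + Y q f * X q g)" by simp
qed

lemma lie_tangent:
  assumes "smooth_vf A X" "smooth_vf A Y" "q \<in> points A"
  shows "lie A X Y q \<in> tangent_space A q"
proof (rule tangentI)
  fix f g :: "'m \<Rightarrow> real" assume f: "smooth_at A f q" and g: "smooth_at A g q"
  show "lie A X Y q (\<lambda>x. f x + g x) = lie A X Y q f + lie A X Y q g"
    using assms f g by (simp add: lie_apply vf_vf_add smooth_at_add)
  show "lie A X Y q (\<lambda>x. f x * g x) = f q * lie A X Y q g + g q * lie A X Y q f"
    using assms f g by (simp add: lie_apply vf_vf_mult smooth_at_mult algebra_simps)
next
  fix f :: "'m \<Rightarrow> real" and r assume f: "smooth_at A f q"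
  \<comment> \<open>Scaling by \<open>r\<close> is treated as multiplication by a constant function,
    so that \<open>vf_vf_mult\<close> applies and every derivative of that function
    vanishes.\<close>
  have "X q (\<lambda>x. r) = 0" "Y q (\<lambda>x. r) = 0" "X q (\<lambda>x. Y x (\<lambda>y. r)) = 0" "Y q (\<lambda>x. X x (\<lambda>y. r)) = 0"
  proof -
    show "X q (\<lambda>x. r) = 0" "Y q (\<lambda>x. r) = 0"
      using tan_const[OF vf_tangent[OF assms(1,3)]] tan_const[OF vf_tangent[OF assms(2,3)]] by simp_all
    have "eventually (\<lambda>x. Y x (\<lambda>y. r) = 0) (nhdsin T q)" "eventually (\<lambda>x. X x (\<lambda>y. r) = 0) (nhdsin T q)"
      by (rule eventually_mono[OF eventually_points], rule tan_const[OF vf_tangent], rule assms, assumption)+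
    from tan_cong[OF vf_tangent[OF assms(1,3)] assms(3) this(1)]
      tan_cong[OF vf_tangent[OF assms(2,3)] assms(3) this(2)]
    show "X q (\<lambda>x. Y x (\<lambda>y. r)) = 0" "Y q (\<lambda>x. X x (\<lambda>y. r)) = 0"
      using tan_const[OF vf_tangent[OF assms(1,3)]] tan_const[OF vf_tangent[OF assms(2,3)]] by simp_all
  qed
  then show "lie A X Y q (\<lambda>x. r * f x) = r * lie A X Y q f"
    using vf_vf_mult[OF assms(1,2,3) smooth_at_const f] vf_vf_mult[OF assms(2,1,3) smooth_at_const f] f
    by (simp add: lie_apply smooth_at_cmult algebra_simps)
qed (simp add: lie_def)

lemma smooth_vf_lie:
  assumes "smooth_vf A X" "smooth_vf A Y"
  shows "smooth_vf A (lie A X Y)"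
  unfolding smooth_vf_def
proof (intro ballI conjI allI impI)
  fix q assume q: "q \<in> points A"
  show "lie A X Y q \<in> tangent_space A q" using assms q by (rule lie_tangent)
  fix f :: "'m \<Rightarrow> real" assume f: "smooth_at A f q"
  have "eventually (\<lambda>x. lie A X Y x f = X x (\<lambda>y. Y y f) - Y x (\<lambda>y. X y f)) (nhdsin T q)"
    using smooth_at_eventually[OF f] by (rule eventually_mono) (rule lie_apply)
  then show "smooth_at A (\<lambda>x. lie A X Y x f) q"
    using q f assms by (simp add: smooth_at_cong smooth_at_diff vf_smooth)
qed

lemma lie_swap: "lie A X Y q = - lie A Y X q"
  by (simp add: lie_def fun_eq_iff)

text \<open>The bracket differentiates \<open>Y\<close>, so equality at \<open>q\<close> alone would
  not suffice; equality on \<open>points A\<close> is equality near \<open>q\<close>.\<close>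

lemma lie_cong:
  assumes "smooth_vf A X" "smooth_vf A Y" "q \<in> points A"
    "\<And>x. x \<in> points A \<Longrightarrow> Y x = Z x"
  shows "lie A X Y q = lie A X Z q"
proof
  fix f
  have "eventually (\<lambda>x. Y x f = Z x f) (nhdsin T q)"
    using eventually_points by (rule eventually_mono) (simp add: assms(4))
  from tan_cong[OF vf_tangent[OF assms(1,3)] assms(3) this]
  show "lie A X Y q f = lie A X Z q f"
    using assms(3,4) by (simp add: lie_def)
qed

lemma smooth_vf_add:
  assumes "smooth_vf A X" "smooth_vf A Y"
  shows "smooth_vf A (\<lambda>x. X x + Y x)"
  using assms subspace_add[OF subspace_tangent] by (auto simp: smooth_vf_def smooth_at_add)

lemma smooth_vf_scale:
  assumes "smooth_vf A X" "\<And>q. q \<in> points A \<Longrightarrow> smooth_at A a q"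
  shows "smooth_vf A (\<lambda>x. a x *\<^sub>R X x)"
  using assms subspace_scale[OF subspace_tangent] by (auto simp: smooth_vf_def smooth_at_mult)

lemma lie_add_right:
  assumes "smooth_vf A X" "smooth_vf A Y" "smooth_vf A Z" "q \<in> points A"
  shows "lie A X (\<lambda>x. Y x + Z x) q = lie A X Y q + lie A X Z q"
proof (rule tangent_ext)
  show "lie A X (\<lambda>x. Y x + Z x) q \<in> tangent_space A q"
    using assms by (intro lie_tangent smooth_vf_add)
  show "lie A X Y q + lie A X Z q \<in> tangent_space A q"
    using assms by (intro subspace_add[OF subspace_tangent] lie_tangent)
next
  fix f :: "'m \<Rightarrow> real" assume f: "smooth_at A f q"
  show "lie A X (\<lambda>x. Y x + Z x) q f = (lie A X Y q + lie A X Z q) f"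
    using f tan_add[OF vf_tangent[OF assms(1,4)] vf_smooth[OF assms(2,4) f] vf_smooth[OF assms(3,4) f]]
    by (simp add: lie_apply)
qed

lemma lie_scale_right:
  assumes "smooth_vf A X" "smooth_vf A Y" "\<And>q. q \<in> points A \<Longrightarrow> smooth_at A a q" "q \<in> points A"
  shows "lie A X (\<lambda>x. a x *\<^sub>R Y x) q = a q *\<^sub>R lie A X Y q + X q a *\<^sub>R Y q"
proof (rule tangent_ext)
  show "lie A X (\<lambda>x. a x *\<^sub>R Y x) q \<in> tangent_space A q"
    using assms by (intro lie_tangent smooth_vf_scale)
  show "a q *\<^sub>R lie A X Y q + X q a *\<^sub>R Y q \<in> tangent_space A q"
    using assms by (intro subspace_add[OF subspace_tangent] subspace_scale[OF subspace_tangent] lie_tangent vf_tangent)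
next
  fix f :: "'m \<Rightarrow> real" assume f: "smooth_at A f q"
  show "lie A X (\<lambda>x. a x *\<^sub>R Y x) q f = (a q *\<^sub>R lie A X Y q + X q a *\<^sub>R Y q) f"
    using f tan_mult[OF vf_tangent[OF assms(1,4)] assms(3)[OF assms(4)] vf_smooth[OF assms(2,4) f]]
    by (simp add: lie_apply algebra_simps)
qed

lemma lie_lincomb_right:
  assumes "smooth_vf A X" "smooth_vf A f1" "smooth_vf A f2"
    "\<And>q. q \<in> points A \<Longrightarrow> smooth_at A a q" "\<And>q. q \<in> points A \<Longrightarrow> smooth_at A b q" "q \<in> points A"
  shows "lie A X (\<lambda>x. a x *\<^sub>R f1 x + b x *\<^sub>R f2 x) q =
    a q *\<^sub>R lie A X f1 q + b q *\<^sub>R lie A X f2 q + (X q a *\<^sub>R f1 q + X q b *\<^sub>R f2 q)"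
  using assms by (simp add: lie_add_right smooth_vf_scale lie_scale_right)

text \<open>Cramer's rule, applied to the values of the vector fields on two functions
  that separate \<open>f1 q\<close> and \<open>f2 q\<close>.\<close>

lemma smooth_coefficients:
  assumes X: "smooth_vf A X" and f1: "smooth_vf A f1" and f2: "smooth_vf A f2"
    and eq: "\<And>x. x \<in> points A \<Longrightarrow> X x = a x *\<^sub>R f1 x + b x *\<^sub>R f2 x"
    and ind: "independent {f1 q, f2 q}" "f1 q \<noteq> f2 q" and q: "q \<in> points A"
  shows "smooth_at A a q \<and> smooth_at A b q"
proof -
  have "f1 q \<noteq> 0" using ind(1) dependent_zero[of "{f1 q, f2 q}"] by auto
  then obtain h where h: "f1 q h \<noteq> 0" by (auto simp: fun_eq_iff)
  let ?r = "f2 q h / f1 q h"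
  have "f2 q \<noteq> ?r *\<^sub>R f1 q"
  proof
    assume "f2 q = ?r *\<^sub>R f1 q"
    then have "f2 q \<in> span {f1 q}" by (metis span_base span_scale insertI1)
    with ind show False by (simp add: insert_commute[of "f1 q"] independent_insert)
  qed
  then obtain k where k: "f2 q k \<noteq> ?r * f1 q k" by (auto simp: fun_eq_iff)
  \<comment> \<open>The determinant of the linear system for \<open>a x\<close> and
    \<open>b x\<close>, nonzero at \<open>q\<close> by the choice of \<open>h\<close> and
    \<open>k\<close>. Both functions are smooth at \<open>q\<close>, because tangent vectors vanish
    on all others.\<close>
  define d where "d x = f1 x h * f2 x k - f2 x h * f1 x k" for x
  have d: "d q \<noteq> 0" using h k by (auto simp: d_def field_simps)
  have "smooth_at A h q"
    using h tan_not_smooth[OF vf_tangent[OF f1 q]] by blast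
  moreover have "smooth_at A k q"
  proof (rule ccontr)
    assume "\<not> smooth_at A k q"
    then have "f1 q k = 0" "f2 q k = 0"
      using tan_not_smooth[OF vf_tangent[OF f1 q]] tan_not_smooth[OF vf_tangent[OF f2 q]] by auto
    with k show False by simp
  qed
  ultimately have "smooth_at A h q" "smooth_at A k q" by auto
  note s = this[THEN vf_smooth[OF X q]] this[THEN vf_smooth[OF f1 q]] this[THEN vf_smooth[OF f2 q]]
  have sd: "smooth_at A d q"
    unfolding d_def by (intro smooth_at_diff smooth_at_mult s)
  have e: "eventually (\<lambda>x. d x \<noteq> 0 \<and> x \<in> points A) (nhdsin T q)"
    using smooth_at_nonzero[OF sd d] eventually_points by (rule eventually_conj)
  have "eventually (\<lambda>x. a x = (X x h * f2 x k - f2 x h * X x k) * inverse (d x)) (nhdsin T q)"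
    using e by (rule eventually_mono) (simp add: eq field_simps, simp add: d_def algebra_simps)
  moreover have "smooth_at A (\<lambda>x. (X x h * f2 x k - f2 x h * X x k) * inverse (d x)) q"
    by (intro smooth_at_mult smooth_at_diff smooth_at_inverse s sd d)
  moreover have "eventually (\<lambda>x. b x = (f1 x h * X x k - X x h * f1 x k) * inverse (d x)) (nhdsin T q)"
    using e by (rule eventually_mono) (simp add: eq field_simps, simp add: d_def algebra_simps)
  moreover have "smooth_at A (\<lambda>x. (f1 x h * X x k - X x h * f1 x k) * inverse (d x)) q"
    by (intro smooth_at_mult smooth_at_diff smooth_at_inverse s sd d)
  ultimately show ?thesis using q by (simp add: smooth_at_cong)
qed

section \<open>The cotangent bundle\<close>

lemma cot_add: "p \<in> cotangent_space A q \<Longrightarrow> v \<in> tangent_space A q \<Longrightarrow> w \<in> tangent_space A q \<Longrightarrow>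
    p (v + w) = p v + p w"
  and cot_scale: "p \<in> cotangent_space A q \<Longrightarrow> v \<in> tangent_space A q \<Longrightarrow> p (r *\<^sub>R v) = r * p v"
  and cot_outside: "p \<in> cotangent_space A q \<Longrightarrow> v \<notin> tangent_space A q \<Longrightarrow> p v = 0"
  by (auto simp: cotangent_space_def)

lemma cot_zero: "p \<in> cotangent_space A q \<Longrightarrow> p 0 = 0"
  using cot_scale[of p q 0 0] subspace_0[OF subspace_tangent] by simp

lemma cot_lincomb:
  assumes "p \<in> cotangent_space A q" "\<And>i. i \<in> I \<Longrightarrow> v i \<in> tangent_space A q"
  shows "p (\<Sum>i\<in>I. r i *\<^sub>R v i) = (\<Sum>i\<in>I. r i * p (v i))"
  using assms(2)
proof (induction I rule: infinite_finite_induct)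
  case (insert i I)
  have 1: "(\<Sum>i\<in>I. r i *\<^sub>R v i) \<in> tangent_space A q"
    using insert.prems by (intro subspace_sum subspace_scale subspace_tangent) auto
  have 2: "r i *\<^sub>R v i \<in> tangent_space A q"
    using insert.prems by (intro subspace_scale subspace_tangent) auto
  have "p (\<Sum>i\<in>I. r i *\<^sub>R v i) = (\<Sum>i\<in>I. r i * p (v i))" "p (r i *\<^sub>R v i) = r i * p (v i)"
    using insert cot_scale[OF assms(1)] by blast+
  then show ?case
    using cot_add[OF assms(1) 2 1] by (simp only: sum.insert[OF insert.hyps])
qed (simp_all add: cot_zero[OF assms(1)])

lemma cot_expand:
  assumes "c \<in> A" "q \<in> fst c" "p \<in> cotangent_space A q" "v \<in> tangent_space A q"
  shows "p v = (\<Sum>b\<in>Basis. v (\<lambda>x. snd c x \<bullet> b) * p (coord_vec A c b q))"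
proof -
  have "p v = p (\<Sum>b\<in>Basis. v (\<lambda>x. snd c x \<bullet> b) *\<^sub>R coord_vec A c b q)"
    using tangent_expand[OF assms(1,2,4)] by simp
  also have "\<dots> = (\<Sum>b\<in>Basis. v (\<lambda>x. snd c x \<bullet> b) * p (coord_vec A c b q))"
    using assms(3) coord_vec_tangent[OF assms(1,2)] by (rule cot_lincomb)
  finally show ?thesis .
qed

text \<open>Inverse of the fibre coordinates of \<open>cotangent_chart\<close>: the covector with
  components \<open>\<xi>\<close> in the frame dual to the coordinate derivations, set to 0 off the
  tangent space as \<open>cotangent_space\<close> demands.\<close>

definition covec_of :: "('m, 'e) chart \<Rightarrow> 'm \<Rightarrow> 'e \<Rightarrow> 'm tvec \<Rightarrow> real" where
  "covec_of c q \<xi> v =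
     (if v \<in> tangent_space A q then \<Sum>b\<in>Basis. (\<xi> \<bullet> b) * v (\<lambda>x. snd c x \<bullet> b) else 0)"

lemma covec_of_cotangent: "covec_of c q \<xi> \<in> cotangent_space A q"
  unfolding cotangent_space_def covec_of_def
  by (auto simp: subspace_add[OF subspace_tangent] subspace_scale[OF subspace_tangent]
      sum.distrib sum_distrib_left algebra_simps)

lemma covec_of_coord_vec:
  "c \<in> A \<Longrightarrow> q \<in> fst c \<Longrightarrow> b \<in> Basis \<Longrightarrow> covec_of c q \<xi> (coord_vec A c b q) = \<xi> \<bullet> b"
  by (simp add: covec_of_def coord_vec_tangent coord_vec_coord inner_Basis if_distrib sum.If_cases)

section \<open>Canonical charts of the cotangent bundle\<close>

lemma fst_cotangent_chart: "(q, p) \<in> fst (cotangent_chart A c) \<longleftrightarrow> q \<in> fst c \<and> p \<in> cotangent_space A q"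
  by (simp add: cotangent_chart_def)

lemma snd_cotangent_chart:
  "snd (cotangent_chart A c) (q, p) = (snd c q, \<Sum>b\<in>Basis. p (coord_vec A c b q) *\<^sub>R b)"
  by (simp add: cotangent_chart_def)

text \<open>A covector is determined by its values on the coordinate derivations. Injectivity is
  what allows \<open>inv_into\<close> to be computed as \<open>covec_of\<close>.\<close>

lemma cotangent_chart_inj:
  assumes "c \<in> A"
  shows "inj_on (snd (cotangent_chart A c)) (fst (cotangent_chart A c))"
proof (rule inj_onI, clarify)
  fix q p q' p'
  assume "(q, p) \<in> fst (cotangent_chart A c)" "(q', p') \<in> fst (cotangent_chart A c)"
    and eq: "snd (cotangent_chart A c) (q, p) = snd (cotangent_chart A c) (q', p')"
  then have q: "q \<in> fst c" "q' \<in> fst c" and p: "p \<in> cotangent_space A q" "p' \<in> cotangent_space A q'"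
    by (auto simp: fst_cotangent_chart)
  have "snd c q = snd c q'" using eq by (simp add: snd_cotangent_chart)
  then have qq: "q' = q" using chart_inj[OF assms] q by (simp add: inj_on_eq_iff)
  have "p (coord_vec A c b q) = p' (coord_vec A c b q)" if "b \<in> Basis" for b
  proof -
    have "(\<Sum>b\<in>Basis. p (coord_vec A c b q) *\<^sub>R b) = (\<Sum>b\<in>Basis. p' (coord_vec A c b q) *\<^sub>R b)"
      using eq unfolding snd_cotangent_chart qq by simp
    from arg_cong[OF this, of "\<lambda>x. x \<bullet> b"] show ?thesis using that by simp
  qed
  then have "p v = p' v" for v
    using cot_expand[OF assms q(1) p(1)] cot_expand[OF assms q(1) p(2)[unfolded qq]]
      cot_outside[OF p(1)] cot_outside[OF p(2)[unfolded qq]]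
    by (cases "v \<in> tangent_space A q") simp_all
  with qq show "q = q' \<and> p = p'" by auto
qed

lemma cotangent_chart_covec_of:
  assumes "c \<in> A" "q \<in> fst c"
  shows "snd (cotangent_chart A c) (q, covec_of c q \<xi>) = (snd c q, \<xi>)"
  using assms by (simp add: snd_cotangent_chart covec_of_coord_vec euclidean_representation)

lemma cotangent_chart_inv:
  assumes "c \<in> A" "y \<in> snd c ` fst c"
  shows "chart_inv (cotangent_chart A c) (y, \<xi>) = (chart_inv c y, covec_of c (chart_inv c y) \<xi>)"
proof -
  let ?q = "chart_inv c y"
  have q: "?q \<in> fst c" "snd c ?q = y" using assms(2) by (auto simp: inv_into_into f_inv_into_f)
  show ?thesis
    using cotangent_chart_covec_of[OF assms(1) q(1), of \<xi>] q
    by (intro inv_into_f_eq cotangent_chart_inj[OF assms(1)]) (simp_all add: fst_cotangent_chart covec_of_cotangent)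
qed

lemma cotangent_chart_image:
  assumes "c \<in> A"
  shows "snd (cotangent_chart A c) ` fst (cotangent_chart A c) = (snd c ` fst c) \<times> UNIV"
proof (intro set_eqI iffI)
  fix z assume "z \<in> snd (cotangent_chart A c) ` fst (cotangent_chart A c)"
  then show "z \<in> (snd c ` fst c) \<times> UNIV"
    by (auto simp: fst_cotangent_chart snd_cotangent_chart)
next
  fix z :: "'e \<times> 'e" assume "z \<in> (snd c ` fst c) \<times> UNIV"
  then obtain q where q: "q \<in> fst c" "fst z = snd c q" by auto
  have "z = snd (cotangent_chart A c) (q, covec_of c q (snd z))"
    using cotangent_chart_covec_of[OF assms q(1)] q(2) by (simp add: prod_eq_iff)
  moreover have "(q, covec_of c q (snd z)) \<in> fst (cotangent_chart A c)"
    using q(1) covec_of_cotangent by (simp add: fst_cotangent_chart)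
  ultimately show "z \<in> snd (cotangent_chart A c) ` fst (cotangent_chart A c)" by (rule image_eqI)
qed

text \<open>The image of a canonical chart is a product with the whole fibre, hence open, and near
  each of its points a function on the bundle takes this explicit form in coordinates.\<close>

lemma eventually_cotangent_chart:
  assumes "c \<in> A" "q \<in> fst c"
  shows "eventually (\<lambda>z. fst z \<in> snd c ` fst c \<and> chart_inv c (fst z) \<in> fst c \<and>
      h (chart_inv (cotangent_chart A c) z) =
      h (chart_inv c (fst z), covec_of c (chart_inv c (fst z)) (snd z)))
    (nhds (snd (cotangent_chart A c) (q, p)))"
proof -
  have "open ((snd c ` fst c) \<times> (UNIV :: 'e set))"
    using chart_props(2)[OF assms(1)] by (intro open_Times) auto
  then have "eventually (\<lambda>z. z \<in> (snd c ` fst c) \<times> UNIV) (nhds (snd (cotangent_chart A c) (q, p)))"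
    by (rule eventually_nhds_in_open) (simp add: snd_cotangent_chart assms(2))
  then show ?thesis
    by (rule eventually_mono) (auto simp: cotangent_chart_inv[OF assms(1)] inv_into_into)
qed

text \<open>It remains to shrink the neighbourhood into the image of the chart, which is open
  because the fibre coordinates range over the whole model space.\<close>

lemma smooth_at_cotangentI:
  assumes "p \<in> cotangent_space A q"
    "\<And>c. c \<in> A \<Longrightarrow> q \<in> fst c \<Longrightarrow>
      smooth_near (\<lambda>z. h (chart_inv (cotangent_chart A c) z)) (snd (cotangent_chart A c) (q, p))"
  shows "smooth_at (cotangent_atlas A) h (q, p)"
  unfolding smooth_at_def
proof (intro ballI impI)
  fix C assume "C \<in> cotangent_atlas A" and C: "(q, p) \<in> fst C"
  then obtain c where c: "c \<in> A" "C = cotangent_chart A c" by (auto simp: cotangent_atlas_def)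
  have q: "q \<in> fst c" using C c(2) by (simp add: fst_cotangent_chart)
  have "smooth_near (h \<circ> chart_inv C) (snd C (q, p))"
    using assms(2)[OF c(1) q] c(2) by (simp add: o_def)
  moreover have "open (snd C ` fst C)"
    using chart_props(2)[OF c(1)] unfolding c(2) cotangent_chart_image[OF c(1)] by (intro open_Times) auto
  moreover have "snd C (q, p) \<in> snd C ` fst C" using C by (rule imageI)
  ultimately obtain W where "open W" "snd C (q, p) \<in> W" "W \<subseteq> snd C ` fst C" "smooth_on W (h \<circ> chart_inv C)"
    by (rule smooth_nearE)
  then show "\<exists>W. open W \<and> snd C (q, p) \<in> W \<and> W \<subseteq> snd C ` fst C \<and> smooth_on W (h \<circ> chart_inv C)"
    by blast
qed

lemma smooth_at_base:
  assumes "smooth_at A f q" "p \<in> cotangent_space A q"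
  shows "smooth_at (cotangent_atlas A) (f \<circ> fst) (q, p)"
  using assms(2)
proof (rule smooth_at_cotangentI)
  fix c assume c: "c \<in> A" "q \<in> fst c"
  have s: "smooth_near (\<lambda>z. f (chart_inv c (fst z))) (snd (cotangent_chart A c) (q, p))"
    by (rule smooth_near_compose[OF smooth_near_linear[OF bounded_linear_fst], where g="\<lambda>y. f (chart_inv c y)"])
      (use assms(1) in \<open>simp add: snd_cotangent_chart smooth_at_chart[OF c]\<close>)
  show "smooth_near (\<lambda>z. (f \<circ> fst) (chart_inv (cotangent_chart A c) z)) (snd (cotangent_chart A c) (q, p))"
    using eventually_mono[OF eventually_cotangent_chart[OF c, of "f \<circ> fst"]] s
    by (rule smooth_near_cong) simp
qed

text \<open>In canonical coordinates \<open>f \<circ> fst\<close> depends on the base component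
  only, so the fibre direction \<open>\<eta>\<close> contributes nothing.\<close>

lemma coord_vec_base:
  assumes "smooth_at A f q" "p \<in> cotangent_space A q" "c \<in> A" "q \<in> fst c"
  shows "coord_vec (cotangent_atlas A) (cotangent_chart A c) (e, \<eta>) (q, p) (f \<circ> fst) = coord_vec A c e q f"
proof -
  let ?f = "\<lambda>y. f (chart_inv c y)" and ?z = "snd (cotangent_chart A c) (q, p)"
  have z: "fst ?z = snd c q" by (simp add: snd_cotangent_chart)
  have "(?f has_derivative frechet_derivative ?f (at (snd c q))) (at (snd c q))"
    using assms(1) unfolding smooth_at_chart[OF assms(3,4)] by (rule smooth_near_has_derivative)
  then have "((\<lambda>z. ?f (fst z)) has_derivative (\<lambda>z. frechet_derivative ?f (at (snd c q)) (fst z))) (at ?z)"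
    using has_derivative_compose[OF has_derivative_fst[OF has_derivative_ident]] unfolding z[symmetric] by blast
  then have "((\<lambda>z. (f \<circ> fst) (chart_inv (cotangent_chart A c) z)) has_derivative
      (\<lambda>z. frechet_derivative ?f (at (snd c q)) (fst z))) (at ?z)"
    by (rule has_derivative_cong_nhds)
      (rule eventually_mono[OF eventually_cotangent_chart[OF assms(3,4), of "f \<circ> fst"]], simp)
  from frechet_derivative_at[OF this] show ?thesis
    using assms(1) smooth_at_base[OF assms(1,2)] by (simp add: coord_vec_def o_def fun_eq_iff)
qed

section \<open>Hamiltonian fields of fibrewise linear functions\<close>

context
  fixes X :: "'m vfield"
  assumes X: "smooth_vf A X"
begin

text \<open>In canonical coordinates the Hamiltonian is the pairing of the momentum with the
  components of \<open>X\<close>; its regularity and its derivatives are read off from this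
  form.\<close>

lemma lin_ham_chart:
  assumes "c \<in> A" "q \<in> fst c"
  shows "eventually (\<lambda>z. (\<Sum>b\<in>Basis. (snd z \<bullet> b) * X (chart_inv c (fst z)) (\<lambda>x. snd c x \<bullet> b)) =
      lin_ham X (chart_inv (cotangent_chart A c) z)) (nhds (snd (cotangent_chart A c) (q, p)))"
  using eventually_cotangent_chart[OF assms, of "lin_ham X"]
proof eventually_elim
  case (elim z)
  then have "X (chart_inv c (fst z)) \<in> tangent_space A (chart_inv c (fst z))"
    using assms(1) by (auto intro: vf_tangent[OF X] points_chart)
  with elim show ?case by (simp add: lin_ham_def covec_of_def)
qed

lemma smooth_near_component:
  assumes "c \<in> A" "q \<in> fst c"
  shows "smooth_near (\<lambda>y. X (chart_inv c y) (\<lambda>x. snd c x \<bullet> b)) (snd c q)"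
  using vf_smooth[OF X points_chart[OF assms] smooth_at_coord[OF assms]]
  unfolding smooth_at_chart[OF assms] .

lemma smooth_at_lin_ham:
  assumes "p \<in> cotangent_space A q"
  shows "smooth_at (cotangent_atlas A) (lin_ham X) (q, p)"
  using assms
proof (rule smooth_at_cotangentI)
  fix c assume c: "c \<in> A" "q \<in> fst c"
  let ?z = "snd (cotangent_chart A c) (q, p)"
  have "smooth_near (\<lambda>z. X (chart_inv c (fst z)) (\<lambda>x. snd c x \<bullet> b)) ?z" for b
    by (rule smooth_near_compose[OF smooth_near_linear[OF bounded_linear_fst]])
      (use smooth_near_component[OF c] in \<open>simp add: snd_cotangent_chart\<close>)
  moreover have "smooth_near (\<lambda>z. snd z \<bullet> b) ?z" for b
    by (intro smooth_near_linear bounded_linear_compose[OF bounded_linear_inner_left bounded_linear_snd])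
  ultimately have s: "smooth_near (\<lambda>z. (snd z \<bullet> b) * X (chart_inv c (fst z)) (\<lambda>x. snd c x \<bullet> b)) ?z" for b
    using smooth_near_scaleR[of "\<lambda>z. snd z \<bullet> b" ?z "\<lambda>z. X (chart_inv c (fst z)) (\<lambda>x. snd c x \<bullet> b)"]
    by simp
  have "smooth_near (\<lambda>z. \<Sum>b\<in>Basis. (snd z \<bullet> b) * X (chart_inv c (fst z)) (\<lambda>x. snd c x \<bullet> b)) ?z"
    by (intro smooth_near_sum s)
  with lin_ham_chart[OF c] show "smooth_near (\<lambda>z. lin_ham X (chart_inv (cotangent_chart A c) z)) ?z"
    by (rule smooth_near_cong)
qed

text \<open>The Hamiltonian is linear in the momentum, so its derivative in the fibre direction
  \<open>b\<close> is the component of \<open>X\<close> along \<open>b\<close>. The terms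
  differentiating the components of \<open>X\<close> see the base direction 0 and vanish.\<close>

lemma coord_vec_lin_ham:
  assumes "p \<in> cotangent_space A q" "c \<in> A" "q \<in> fst c" "b \<in> Basis"
  shows "coord_vec (cotangent_atlas A) (cotangent_chart A c) (0, b) (q, p) (lin_ham X) =
    X q (\<lambda>x. snd c x \<bullet> b)"
proof -
  let ?z = "snd (cotangent_chart A c) (q, p)"
  let ?G = "\<lambda>b y. X (chart_inv c y) (\<lambda>x. snd c x \<bullet> b)"
  let ?D = "\<lambda>b. frechet_derivative (?G b) (at (fst ?z))"
  have z: "fst ?z = snd c q" by (simp add: snd_cotangent_chart)
  have D: "(?G b has_derivative ?D b) (at (fst ?z))" for b
    unfolding z using smooth_near_component[OF assms(2,3)] by (rule smooth_near_has_derivative)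
  then have "((\<lambda>z. ?G b (fst z)) has_derivative (\<lambda>z. ?D b (fst z))) (at ?z)" for b
    using has_derivative_compose[OF has_derivative_fst[OF has_derivative_ident]] by blast
  then have "((\<lambda>z. \<Sum>b\<in>Basis. (snd z \<bullet> b) * ?G b (fst z)) has_derivative
      (\<lambda>z. \<Sum>b\<in>Basis. (snd ?z \<bullet> b) * ?D b (fst z) + (snd z \<bullet> b) * ?G b (fst ?z))) (at ?z)"
    by (intro has_derivative_sum has_derivative_mult has_derivative_inner_left has_derivative_snd has_derivative_ident)
  then have "((\<lambda>z. lin_ham X (chart_inv (cotangent_chart A c) z)) has_derivative
      (\<lambda>z. \<Sum>b\<in>Basis. (snd ?z \<bullet> b) * ?D b (fst z) + (snd z \<bullet> b) * ?G b (fst ?z))) (at ?z)"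
    using lin_ham_chart[OF assms(2,3)] by (rule has_derivative_cong_nhds)
  from frechet_derivative_at[OF this]
  have "coord_vec (cotangent_atlas A) (cotangent_chart A c) (0, b) (q, p) (lin_ham X) =
      (\<Sum>b'\<in>Basis. (snd ?z \<bullet> b') * ?D b' 0 + (b \<bullet> b') * ?G b' (fst ?z))"
    using smooth_at_lin_ham[OF assms(1)] by (simp add: coord_vec_def o_def fun_eq_iff)
  also have "\<dots> = (\<Sum>b'\<in>Basis. (b \<bullet> b') * ?G b' (fst ?z))"
    using linear_0[OF has_derivative_linear[OF D]] by simp
  also have "\<dots> = (\<Sum>b'\<in>Basis. if b = b' then ?G b' (fst ?z) else 0)"
    using assms(4) by (intro sum.cong) (simp_all add: inner_Basis)
  also have "\<dots> = ?G b (fst ?z)"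
    using assms(4) by simp
  finally show ?thesis unfolding z using assms(2,3) by simp
qed

text \<open>Tested on functions pulled back from the base, the fibre part of the Hamiltonian field
  gives 0. The base part has the fibre derivatives of the Hamiltonian as coefficients, which are the
  components of \<open>X\<close>.\<close>

lemma pushforward_hamiltonian_vf:
  assumes "q \<in> points A" "p \<in> cotangent_space A q"
  shows "pushforward (cotangent_atlas A) fst A (q, p) (hamiltonian_vf A (lin_ham X) (q, p)) = X q"
proof
  fix f :: "'m \<Rightarrow> real"
  let ?B = "cotangent_atlas A"
  \<comment> \<open>The very chart that \<open>hamiltonian_vf\<close> selects.\<close>
  define c where "c = (SOME c. c \<in> A \<and> q \<in> fst c)"
  have "\<exists>c. c \<in> A \<and> q \<in> fst c" using assms(1) by (auto simp: points_def)
  then have "c \<in> A \<and> q \<in> fst c" unfolding c_def by (rule someI_ex)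
  then have c: "c \<in> A" "q \<in> fst c" by auto
  let ?C = "cotangent_chart A c"
  show "pushforward ?B fst A (q, p) (hamiltonian_vf A (lin_ham X) (q, p)) f = X q f"
  proof (cases "smooth_at A f q")
    case True
    have zero: "coord_vec A c 0 q f = 0"
      using linear_0[OF has_derivative_linear[OF smooth_near_has_derivative[OF True[unfolded smooth_at_chart[OF c]]]]]
      by (simp add: coord_vec_def o_def)
    have "hamiltonian_vf A (lin_ham X) (q, p) (f \<circ> fst) =
        (\<Sum>b\<in>Basis. X q (\<lambda>x. snd c x \<bullet> b) * coord_vec A c b q f)"
      unfolding hamiltonian_vf_def Let_def sum_fun_apply fst_conv c_def[symmetric]
      by (intro sum.cong refl)
        (simp add: coord_vec_base[OF True assms(2) c] coord_vec_lin_ham[OF assms(2) c] zero)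
    also have "\<dots> = (\<Sum>b\<in>Basis. X q (\<lambda>x. snd c x \<bullet> b) *\<^sub>R coord_vec A c b q) f"
      by (simp add: sum_fun_apply)
    also have "\<dots> = X q f"
      using tangent_expand[OF c vf_tangent[OF X assms(1)]] by simp
    finally show ?thesis using True by (simp add: pushforward_def)
  next
    case False
    then show ?thesis using tan_not_smooth[OF vf_tangent[OF X assms(1)]] by (simp add: pushforward_def)
  qed
qed

end

end

section \<open>Extremal velocities and the reduction\<close>

lemma span_pair: "v \<in> span {a, b} \<longleftrightarrow> (\<exists>x y. v = x *\<^sub>R a + y *\<^sub>R b)"
  for a b v :: "'a::real_vector"
  by (simp add: span_breakdown_eq[of _ a] span_breakdown_eq[of _ b] algebra_simps)

lemma independent_pair_coeffs:
  fixes a b :: "'a::real_vector"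
  assumes "independent {a, b}" "a \<noteq> b" "x *\<^sub>R a + y *\<^sub>R b = x' *\<^sub>R a + y' *\<^sub>R b"
  shows "x = x' \<and> y = y'"
proof -
  have b: "a \<notin> span {b}" "b \<notin> span {a}"
    using assms(1)[unfolded independent_insert[of a "{b}"]]
      assms(1)[unfolded insert_commute[of a b "{}"] independent_insert[of b "{a}"]] assms(2) by auto
  have e: "(x - x') *\<^sub>R a = (y' - y) *\<^sub>R b" using assms(3) by (simp add: algebra_simps)
  have "x = x'"
  proof (rule ccontr)
    assume "x \<noteq> x'"
    then have "a = ((y' - y) / (x - x')) *\<^sub>R b"
      using arg_cong[OF e, of "\<lambda>v. (1 / (x - x')) *\<^sub>R v"] by simp
    then show False using b(1) by (metis insertI1 span_base span_scale)
  qed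
  moreover have "y = y'"
  proof (rule ccontr)
    assume "y \<noteq> y'"
    then have "b = 0" using e \<open>x = x'\<close> by simp
    then show False using b(2) span_zero by blast
  qed
  ultimately show ?thesis by blast
qed

section \<open>Covectors with a common kernel\<close>

context smooth_mfd
begin

lemma cot_neg: "p \<in> cotangent_space A q \<Longrightarrow> v \<in> tangent_space A q \<Longrightarrow> p (- v) = - p v"
  using cot_scale[of p q v "-1"] by simp

lemma cot_lie_swap:
  assumes "p \<in> cotangent_space A q" "smooth_vf A X" "smooth_vf A Y" "q \<in> points A"
  shows "p (lie A X Y q) = - p (lie A Y X q)"
  unfolding lie_swap[of X Y] by (rule cot_neg[OF assms(1) lie_tangent[OF assms(3,2,4)]])

text \<open>Used with \<open>r = 1\<close>, \<open>r' = 0\<close> for the kernel of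
  \<open>p\<close>, and with general factors for the set where two covectors are proportional. It is
  cut down to the tangent space because covectors are linear only there.\<close>

lemma subspace_cot_eq:
  assumes "p \<in> cotangent_space A q" "p' \<in> cotangent_space A q"
  shows "subspace {v \<in> tangent_space A q. r * p v = r' * p' v}"
proof (rule subspaceI)
  show "0 \<in> {v \<in> tangent_space A q. r * p v = r' * p' v}"
    using assms by (simp add: cot_zero subspace_0[OF subspace_tangent])
  show "x + y \<in> {v \<in> tangent_space A q. r * p v = r' * p' v}"
    if "x \<in> {v \<in> tangent_space A q. r * p v = r' * p' v}" "y \<in> {v \<in> tangent_space A q. r * p v = r' * p' v}" for x y
    using assms that subspace_add[OF subspace_tangent, of x q y]
    by (simp add: cot_add[where q=q] distrib_left)
  show "c *\<^sub>R x \<in> {v \<in> tangent_space A q. r * p v = r' * p' v}"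
    if "x \<in> {v \<in> tangent_space A q. r * p v = r' * p' v}" for c x
    using assms that subspace_scale[OF subspace_tangent, of x q c] cot_scale[OF assms(1), of x c] cot_scale[OF assms(2), of x c]
    by (simp add: mult.left_commute)
qed

text \<open>Both covectors vanish on the independent vectors \<open>a\<close>, \<open>b\<close>,
  \<open>w\<close>, and \<open>u\<close> lies outside their span since
  \<open>p u \<noteq> 0\<close>. In dimension four these four vectors span the tangent space, for a
  fifth independent one would exceed the bound on generators. So it suffices to compare the two
  sides on them.\<close>

lemma cot_proportional:
  assumes "q \<in> points A" "DIM('e) = 4"
    and p: "p \<in> cotangent_space A q" "p' \<in> cotangent_space A q"
    and T: "a \<in> tangent_space A q" "b \<in> tangent_space A q" "w \<in> tangent_space A q"
      "u \<in> tangent_space A q" "v \<in> tangent_space A q"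
    and ker: "p a = 0" "p b = 0" "p w = 0" "p' a = 0" "p' b = 0" "p' w = 0"
    and u: "p u \<noteq> 0" and ind: "independent {a, b}" "a \<noteq> b" and w: "w \<notin> span {a, b}"
  shows "p u * p' v = p' u * p v"
proof -
  have "span {w, a, b} \<subseteq> {v \<in> tangent_space A q. 1 * p v = 0 * p v}"
    by (rule span_minimal[OF _ subspace_cot_eq[OF p(1) p(1)]]) (simp add: T ker)
  then have "p u = 0" if "u \<in> span {w, a, b}"
    using subsetD[OF _ that] unfolding mem_Collect_eq mult_1 mult_zero_left by blast
  then have u_span: "u \<notin> span {w, a, b}" using u by blast
  have w_notin: "w \<notin> {a, b}" using w span_base[of w "{a, b}"] by argo
  have u_notin: "u \<notin> {w, a, b}" using u_span span_base[of u "{w, a, b}"] by argo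
  have ind4: "independent {u, w, a, b}"
    by (intro independent_insertI u_span w ind(1))
  have "v \<in> span {u, w, a, b}"
  proof (rule ccontr)
    assume v: "v \<notin> span {u, w, a, b}"
    then have v_notin: "v \<notin> {u, w, a, b}" using span_base[of v "{u, w, a, b}"] by argo
    have ind5: "independent (insert v {u, w, a, b})" by (intro independent_insertI v ind4)
    obtain B where B: "finite B" "tangent_space A q \<subseteq> span B" "card B \<le> DIM('e)"
      using assms(1) by (rule finite_tangent_generators)
    have "card (insert v {u, w, a, b}) \<le> card B"
      using independent_span_bound[OF B(1) ind5] B(2) T by blast
    moreover have "card (insert v {u, w, a, b}) = 5"
      using v_notin u_notin w_notin ind(2) by simp
    ultimately show False using B(3) assms(2) by simp
  qed
  moreover have "span {u, w, a, b} \<subseteq> {v \<in> tangent_space A q. p u * p' v = p' u * p v}"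
    by (rule span_minimal[OF _ subspace_cot_eq[OF p(2) p(1)]]) (simp add: T ker mult.commute)
  ultimately show ?thesis by blast
qed

end

section \<open>Sections of the rank two distribution and extremal velocities\<close>

locale rank2_distribution = smooth_mfd T A
  for T :: "'m topology" and A :: "('m, 'e::euclidean_space) atlas" +
  fixes f1 f2 :: "'m vfield"
  assumes f1: "smooth_vf A f1" and f2: "smooth_vf A f2"
    and ind: "q \<in> points A \<Longrightarrow> independent {f1 q, f2 q}"
    and neq: "q \<in> points A \<Longrightarrow> f1 q \<noteq> f2 q"
begin

lemma section_coefficients:
  assumes "smooth_vf A X" "\<And>x. x \<in> points A \<Longrightarrow> X x \<in> span {f1 x, f2 x}"
  obtains a b where "\<And>x. x \<in> points A \<Longrightarrow> X x = a x *\<^sub>R f1 x + b x *\<^sub>R f2 x"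
    "\<And>x. x \<in> points A \<Longrightarrow> smooth_at A a x" "\<And>x. x \<in> points A \<Longrightarrow> smooth_at A b x"
proof -
  have "\<forall>x. \<exists>a b. x \<in> points A \<longrightarrow> X x = a *\<^sub>R f1 x + b *\<^sub>R f2 x"
    using assms(2) by (auto simp: span_pair)
  then obtain a b where ab: "\<And>x. x \<in> points A \<Longrightarrow> X x = a x *\<^sub>R f1 x + b x *\<^sub>R f2 x"
    by metis
  show thesis
    using that[OF ab] smooth_coefficients[OF assms(1) f1 f2 ab ind neq] by blast
qed

lemma lie_section:
  assumes "smooth_vf A X" "smooth_vf A Y" "q \<in> points A"
    "\<And>x. x \<in> points A \<Longrightarrow> Y x = a x *\<^sub>R f1 x + b x *\<^sub>R f2 x"
    "\<And>x. x \<in> points A \<Longrightarrow> smooth_at A a x" "\<And>x. x \<in> points A \<Longrightarrow> smooth_at A b x"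
  shows "lie A X Y q = a q *\<^sub>R lie A X f1 q + b q *\<^sub>R lie A X f2 q + (X q a *\<^sub>R f1 q + X q b *\<^sub>R f2 q)"
  using lie_cong[OF assms(1-4)] lie_lincomb_right[OF assms(1) f1 f2 assms(5,6,3)] by simp

text \<open>The terms that differentiate the coefficients are multiples of \<open>f1 q\<close> and
  \<open>f2 q\<close>, which \<open>p\<close> annihilates. Modulo the distribution the bracket
  therefore depends on \<open>Y\<close> through its value at \<open>q\<close> only.\<close>

lemma cot_lie_section:
  assumes "smooth_vf A X" "smooth_vf A Y" "q \<in> points A"
    "\<And>x. x \<in> points A \<Longrightarrow> Y x = a x *\<^sub>R f1 x + b x *\<^sub>R f2 x"
    "\<And>x. x \<in> points A \<Longrightarrow> smooth_at A a x" "\<And>x. x \<in> points A \<Longrightarrow> smooth_at A b x"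
    and p: "p \<in> cotangent_space A q" "p (f1 q) = 0" "p (f2 q) = 0"
  shows "p (lie A X Y q) = a q * p (lie A X f1 q) + b q * p (lie A X f2 q)"
proof -
  note t = lie_tangent[OF assms(1) f1 assms(3)] lie_tangent[OF assms(1) f2 assms(3)]
    vf_tangent[OF f1 assms(3)] vf_tangent[OF f2 assms(3)]
  note s = t[THEN subspace_scale[OF subspace_tangent]]
  note a = subspace_add[OF subspace_tangent s(1) s(2)] subspace_add[OF subspace_tangent s(3) s(4)]
  show ?thesis
    by (simp only: lie_section[OF assms(1-6)] cot_add[OF p(1) a] cot_add[OF p(1) s(1,2)] cot_add[OF p(1) s(3,4)]
      t[THEN cot_scale[OF p(1)]] p(2,3) mult_zero_right add_0_right)
qed

text \<open>If \<open>p\<close> annihilated \<open>[f1, f2]\<close>, it would annihilate the bracket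
  of any two sections, hence the whole square of the distribution. So the denominator in
  \<open>ext_field\<close> is not zero.\<close>

lemma cot_bracket_nonzero:
  assumes "(q, p) \<in> annihilator A (distribution2 f1 f2) -
      annihilator A (distribution_square A (distribution2 f1 f2))"
  shows "q \<in> points A" "p \<in> cotangent_space A q" "p (f1 q) = 0" "p (f2 q) = 0" "p (lie A f1 f2 q) \<noteq> 0"
proof -
  show q: "q \<in> points A" and p: "p \<in> cotangent_space A q"
    and p1: "p (f1 q) = 0" and p2: "p (f2 q) = 0"
    using assms by (auto simp: annihilator_def distribution2_def span_base)
  show "p (lie A f1 f2 q) \<noteq> 0"
  proof
    assume p12: "p (lie A f1 f2 q) = 0"
    have p11: "p (lie A f1 f1 q) = 0" "p (lie A f2 f2 q) = 0" "p (lie A f2 f1 q) = 0"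
      using cot_lie_swap[OF p f1 f1 q] cot_lie_swap[OF p f2 f2 q] cot_lie_swap[OF p f2 f1 q] p12 by auto
    let ?K = "{v \<in> tangent_space A q. 1 * p v = 0 * p v}"
    have K: "subspace ?K" by (intro subspace_cot_eq p)
    have D: "span {f1 q, f2 q} \<subseteq> ?K"
      by (rule span_minimal[OF _ K]) (simp add: p1 p2 vf_tangent[OF f1 q] vf_tangent[OF f2 q])
    have br: "p (lie A X Y q) = 0" if X: "smooth_vf A X" and Y: "smooth_vf A Y"
      and XY: "\<forall>x\<in>points A. X x \<in> span {f1 x, f2 x} \<and> Y x \<in> span {f1 x, f2 x}" for X Y
    proof -
      obtain a b where ab: "\<And>x. x \<in> points A \<Longrightarrow> X x = a x *\<^sub>R f1 x + b x *\<^sub>R f2 x"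
          "\<And>x. x \<in> points A \<Longrightarrow> smooth_at A a x" "\<And>x. x \<in> points A \<Longrightarrow> smooth_at A b x"
        using section_coefficients[OF X] XY by blast
      obtain c d where cd: "\<And>x. x \<in> points A \<Longrightarrow> Y x = c x *\<^sub>R f1 x + d x *\<^sub>R f2 x"
          "\<And>x. x \<in> points A \<Longrightarrow> smooth_at A c x" "\<And>x. x \<in> points A \<Longrightarrow> smooth_at A d x"
        using section_coefficients[OF Y] XY by blast
      show ?thesis
        \<comment> \<open>Expand \<open>Y\<close>, swap the arguments, then expand \<open>X\<close>;
          what remains are multiples of the values of \<open>p\<close> on brackets of
          \<open>f1\<close> and \<open>f2\<close>.\<close>
        using cot_lie_section[OF X Y q cd p p1 p2] cot_lie_section[OF f1 X q ab p p1 p2]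
          cot_lie_section[OF f2 X q ab p p1 p2] cot_lie_swap[OF p X f1 q] cot_lie_swap[OF p X f2 q] p11 p12
        by simp
    qed
    have "distribution_square A (distribution2 f1 f2) q \<subseteq> ?K"
      unfolding distribution_square_def distribution2_def
    proof (rule span_minimal[OF Un_least[OF D subsetI] K])
      fix v assume "v \<in> {lie A X Y q | X Y. smooth_vf A X \<and> smooth_vf A Y \<and>
          (\<forall>x\<in>points A. X x \<in> span {f1 x, f2 x} \<and> Y x \<in> span {f1 x, f2 x})}"
      then show "v \<in> ?K" using br q by (auto intro: lie_tangent)
    qed
    then have "(q, p) \<in> annihilator A (distribution_square A (distribution2 f1 f2))"
      using q p by (auto simp: annihilator_def)
    with assms show False by blast
  qed
qed

text \<open>Pushing \<open>ext_field\<close> forward term by term turns each Hamiltonian field into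
  its vector field. Here \<open>a\<close> and \<open>b\<close> are the coefficients of
  \<open>ext_field\<close> at the covector \<open>p\<close>, and clearing their denominators gives
  the last two equations.\<close>

lemma Ext_covector:
  assumes f0: "smooth_vf A f0" and v: "v \<in> Ext A f0 f1 f2 q"
  obtains p a b where "p \<in> cotangent_space A q" "p (f1 q) = 0" "p (f2 q) = 0" "p (lie A f1 f2 q) \<noteq> 0"
    "v = f0 q + (a *\<^sub>R f1 q + b *\<^sub>R f2 q)"
    "p (lie A f0 f1 q) = b * p (lie A f1 f2 q)" "p (lie A f0 f2 q) = - a * p (lie A f1 f2 q)"
proof -
  obtain p where p: "(q, p) \<in> annihilator A (distribution2 f1 f2) -
      annihilator A (distribution_square A (distribution2 f1 f2))"
    and v: "v = pushforward (cotangent_atlas A) fst A (q, p) (ext_field A f0 f1 f2 (q, p))"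
    using v unfolding Ext_def Let_def by auto
  note p = cot_bracket_nonzero[OF p]
  let ?a = "p (lie A f0 f2 q) / p (lie A f2 f1 q)" and ?b = "p (lie A f1 f0 q) / p (lie A f2 f1 q)"
  have "v = pushforward (cotangent_atlas A) fst A (q, p) (hamiltonian_vf A (lin_ham f0) (q, p))
      + (?a *\<^sub>R pushforward (cotangent_atlas A) fst A (q, p) (hamiltonian_vf A (lin_ham f1) (q, p))
      + ?b *\<^sub>R pushforward (cotangent_atlas A) fst A (q, p) (hamiltonian_vf A (lin_ham f2) (q, p)))"
    unfolding v by (auto simp: ext_field_def Let_def lin_ham_def pushforward_def fun_eq_iff)
  then have "v = f0 q + (?a *\<^sub>R f1 q + ?b *\<^sub>R f2 q)"
    using p(1,2) f0 f1 f2 by (simp add: pushforward_hamiltonian_vf)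
  moreover have "p (lie A f2 f1 q) = - p (lie A f1 f2 q)" "p (lie A f1 f0 q) = - p (lie A f0 f1 q)"
    by (intro cot_lie_swap p f0 f1 f2)+
  ultimately show thesis
    using p by (intro that[of p ?a ?b]) (simp_all add: field_simps)
qed

end

text \<open>Otherwise all four vectors would lie in the span of three. In the application
  \<open>a\<close> and \<open>b\<close> are the values of \<open>g1\<close> and
  \<open>[g1, g0]\<close>.\<close>

lemma independent_pair_of_dim4:
  fixes a b c d :: "'a::real_vector"
  assumes "dim (span {a, b, c, d}) = 4"
  shows "a \<noteq> 0" "b \<notin> span {a}"
proof -
  have small: "\<not> {a, b, c, d} \<subseteq> span {x, c, d}" for x
  proof
    assume "{a, b, c, d} \<subseteq> span {x, c, d}"
    then have "dim (span {a, b, c, d}) \<le> card {x, c, d}"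
      by (simp add: dim_le_card)
    also have "\<dots> \<le> 3" by (simp add: card_insert_if)
    finally show False using assms by simp
  qed
  have cd: "x \<in> span {x, c, d}" "c \<in> span {x, c, d}" "d \<in> span {x, c, d}" for x
    by (auto intro: span_base)
  show "a \<noteq> 0"
    using small[of b] cd[of b] span_zero[of "{b, c, d}"] by auto
  show "b \<notin> span {a}"
    using small[of a] cd[of a] span_mono[of "{a}" "{a, c, d}"] by auto
qed

lemma control_affine2_indep:
  assumes "control_affine2 A f0 f1 f2" "q \<in> points A"
  shows "independent {f1 q, f2 q}" "f1 q \<noteq> f2 q" "f0 q \<notin> span {f1 q, f2 q}"
proof -
  have ind: "independent (insert (f0 q) {f1 q, f2 q})" and d: "distinct [f0 q, f1 q, f2 q]"
    using assms by (auto simp: control_affine2_def)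
  then show "f1 q \<noteq> f2 q" by simp
  show "independent {f1 q, f2 q}" "f0 q \<notin> span {f1 q, f2 q}"
    using ind d unfolding independent_insert by (simp_all split: if_splits)
qed

section \<open>Systems with a prescribed reduction\<close>

locale reduced_system = rank2_distribution T A f1 f2
  for T :: "'m topology" and A :: "('m, 'e::euclidean_space) atlas" and f1 f2 :: "'m vfield" +
  fixes f0 g0 g1 :: "'m vfield"
  assumes f0: "smooth_vf A f0" and g0: "smooth_vf A g0" and g1: "smooth_vf A g1"
    and g1_nonzero: "q \<in> points A \<Longrightarrow> g1 q \<noteq> 0"
    and reduction: "q \<in> points A \<Longrightarrow> Ext A f0 f1 f2 q = admissible1 g0 g1 q"
begin

lemma admissible_Ext: "q \<in> points A \<Longrightarrow> g0 q + u *\<^sub>R g1 q \<in> Ext A f0 f1 f2 q"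
  unfolding reduction by (auto simp: admissible1_def)

lemma drift_difference: "q \<in> points A \<Longrightarrow> g0 q + u *\<^sub>R g1 q - f0 q \<in> span {f1 q, f2 q}"
  by (rule Ext_covector[OF f0 admissible_Ext[of q u]]) (auto simp: span_pair)

text \<open>The velocities for \<open>u = 1\<close> and \<open>u = 0\<close> differ by
  \<open>g1 q\<close>, and \<open>f0 q\<close> cancels.\<close>

lemma g1_section: "q \<in> points A \<Longrightarrow> g1 q \<in> span {f1 q, f2 q}"
  using span_diff[OF drift_difference[of q 1] drift_difference[of q 0]] by simp

lemma smooth_drift_difference: "smooth_vf A (\<lambda>x. g0 x + (-1) *\<^sub>R f0 x)"
  by (intro smooth_vf_add smooth_vf_scale g0 f0 smooth_at_const)

lemma drift_section: "q \<in> points A \<Longrightarrow> g0 q + (-1) *\<^sub>R f0 q \<in> span {f1 q, f2 q}"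
  using drift_difference[of q 0] by simp

lemma bracket_section:
  assumes dim: "DIM('e) = 4" and q: "q \<in> points A"
  shows "lie A g0 g1 q \<in> span {f1 q, f2 q}"
proof (rule ccontr)
  assume notin: "lie A g0 g1 q \<notin> span {f1 q, f2 q}"
  obtain c d where cd: "\<And>x. x \<in> points A \<Longrightarrow> g1 x = c x *\<^sub>R f1 x + d x *\<^sub>R f2 x"
      "\<And>x. x \<in> points A \<Longrightarrow> smooth_at A c x" "\<And>x. x \<in> points A \<Longrightarrow> smooth_at A d x"
    using section_coefficients[OF g1 g1_section] by blast
  let ?h = "\<lambda>x. g0 x + (-1) *\<^sub>R f0 x"
  obtain a b where ab: "\<And>x. x \<in> points A \<Longrightarrow> ?h x = a x *\<^sub>R f1 x + b x *\<^sub>R f2 x"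
      "\<And>x. x \<in> points A \<Longrightarrow> smooth_at A a x" "\<And>x. x \<in> points A \<Longrightarrow> smooth_at A b x"
    using section_coefficients[OF smooth_drift_difference drift_section] by blast
  have g0_eq: "g0 x = f0 x + ?h x" for x by simp
  \<comment> \<open>For each point \<open>u\<close> of the extremal line a covector that generates
    it. With \<open>g0 = f0 + a f1 + b f2\<close> and \<open>g1 = c f1 + d f2\<close>, the velocity
    has the coefficients \<open>a + u c\<close> and \<open>b + u d\<close>, which enter the
    equations of \<open>Ext_covector\<close>.\<close>
  have ex: "\<exists>p. p \<in> cotangent_space A q \<and> p (f1 q) = 0 \<and> p (f2 q) = 0 \<and> p (lie A f1 f2 q) \<noteq> 0 \<and>
      p (lie A f0 f1 q) = (b q + u * d q) * p (lie A f1 f2 q) \<and>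
      p (lie A f0 f2 q) = - (a q + u * c q) * p (lie A f1 f2 q) \<and>
      p (lie A g0 g1 q) = 0" for u
  proof -
    obtain p x y where p: "p \<in> cotangent_space A q" "p (f1 q) = 0" "p (f2 q) = 0" "p (lie A f1 f2 q) \<noteq> 0"
      and v: "g0 q + u *\<^sub>R g1 q = f0 q + (x *\<^sub>R f1 q + y *\<^sub>R f2 q)"
      and p01: "p (lie A f0 f1 q) = y * p (lie A f1 f2 q)"
      and p02: "p (lie A f0 f2 q) = - x * p (lie A f1 f2 q)"
      using Ext_covector[OF f0 admissible_Ext[OF q, of u]] by metis
    \<comment> \<open>Independence of \<open>f1 q\<close> and \<open>f2 q\<close> identifies the
      coefficients of the velocity.\<close>
    have "x *\<^sub>R f1 q + y *\<^sub>R f2 q = g0 q + u *\<^sub>R g1 q - f0 q"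
      unfolding v by (rule add_diff_cancel_left'[symmetric])
    also have "\<dots> = ?h q + u *\<^sub>R g1 q" by (rule ext) simp
    also have "\<dots> = (a q + u * c q) *\<^sub>R f1 q + (b q + u * d q) *\<^sub>R f2 q"
      unfolding ab(1)[OF q] cd(1)[OF q] by (simp add: fun_eq_iff algebra_simps)
    finally have xy: "x = a q + u * c q" "y = b q + u * d q"
      using independent_pair_coeffs[OF ind[OF q] neq[OF q]] by blast+
    have p11: "p (lie A f1 f1 q) = 0" "p (lie A f2 f2 q) = 0" "p (lie A f2 f1 q) = - p (lie A f1 f2 q)"
      using cot_lie_swap[OF p(1) f1 f1 q] cot_lie_swap[OF p(1) f2 f2 q] cot_lie_swap[OF p(1) f2 f1 q] by auto
    have g: "p (lie A X g0 q) = p (lie A X f0 q) + (a q * p (lie A X f1 q) + b q * p (lie A X f2 q))"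
      if X: "smooth_vf A X" for X
    proof -
      have "lie A X g0 q = lie A X f0 q + lie A X ?h q"
        using lie_cong[OF X g0 q g0_eq] lie_add_right[OF X f0 smooth_drift_difference q] by simp
      then have "p (lie A X g0 q) = p (lie A X f0 q) + p (lie A X ?h q)"
        using cot_add[OF p(1) lie_tangent[OF X f0 q] lie_tangent[OF X smooth_drift_difference q]] by simp
      then show ?thesis
        using cot_lie_section[OF X smooth_drift_difference q ab p(1-3)] by simp
    qed
    \<comment> \<open>Passing from \<open>f0\<close> to \<open>g0\<close> removes \<open>a\<close>
      and \<open>b\<close>, leaving \<open>u d\<close> and \<open>- u c\<close> times
      \<open>p [f1, f2]\<close> on the brackets with \<open>f1\<close> and \<open>f2\<close>;
      weighted with \<open>c\<close> and \<open>d\<close> these cancel.\<close>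
    have "p (lie A g0 g1 q) = c q * p (lie A g0 f1 q) + d q * p (lie A g0 f2 q)"
      by (rule cot_lie_section[OF g0 g1 q cd p(1-3)])
    also have "p (lie A g0 f1 q) = u * d q * p (lie A f1 f2 q)"
      using g[OF f1] p01 p11 xy cot_lie_swap[OF p(1) g0 f1 q] cot_lie_swap[OF p(1) f1 f0 q]
      by (simp add: algebra_simps)
    also have "p (lie A g0 f2 q) = - u * c q * p (lie A f1 f2 q)"
      using g[OF f2] p02 p11 xy cot_lie_swap[OF p(1) g0 f2 q] cot_lie_swap[OF p(1) f2 f0 q]
      by (simp add: algebra_simps)
    finally have "p (lie A g0 g1 q) = 0" by simp
    with p p01 p02 xy show ?thesis by blast
  qed
  obtain p where p: "p \<in> cotangent_space A q" "p (f1 q) = 0" "p (f2 q) = 0" "p (lie A f1 f2 q) \<noteq> 0"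
      "p (lie A f0 f1 q) = b q * p (lie A f1 f2 q)" "p (lie A f0 f2 q) = - a q * p (lie A f1 f2 q)"
      "p (lie A g0 g1 q) = 0"
    using ex[of 0] by auto
  obtain r where r: "r \<in> cotangent_space A q" "r (f1 q) = 0" "r (f2 q) = 0" "r (lie A f1 f2 q) \<noteq> 0"
      "r (lie A f0 f1 q) = (b q + d q) * r (lie A f1 f2 q)"
      "r (lie A f0 f2 q) = - (a q + c q) * r (lie A f1 f2 q)"
      "r (lie A g0 g1 q) = 0"
    using ex[of 1] by auto
  let ?P = "p (lie A f1 f2 q)" and ?R = "r (lie A f1 f2 q)"
  \<comment> \<open>If \<open>[g0, g1]\<close> left the distribution, \<open>p\<close> and
    \<open>r\<close> would share a three-dimensional kernel and be proportional.\<close>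
  have rel: "?P * r v = ?R * p v" if "v \<in> tangent_space A q" for v
    using q dim p(1) r(1) vf_tangent[OF f1 q] vf_tangent[OF f2 q] lie_tangent[OF g0 g1 q]
      lie_tangent[OF f1 f2 q] that p(2,3,7) r(2,3,7) p(4) ind[OF q] neq[OF q] notin
    by (rule cot_proportional[of q p r "f1 q" "f2 q" "lie A g0 g1 q" "lie A f1 f2 q" v])
  \<comment> \<open>Testing proportionality on \<open>[f0, f1]\<close> and \<open>[f0, f2]\<close>,
    where the covectors for \<open>u = 0\<close> and \<open>u = 1\<close> differ by \<open>d\<close>
    and \<open>c\<close>, forces \<open>g1 q = 0\<close>.\<close>
  have "?P * ((b q + d q) * ?R) = ?R * (b q * ?P)" "?P * (- (a q + c q) * ?R) = ?R * (- a q * ?P)"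
    using rel[OF lie_tangent[OF f0 f1 q]] rel[OF lie_tangent[OF f0 f2 q]] unfolding p(5,6) r(5,6) .
  then have "?P * ?R * d q = 0" "?P * ?R * c q = 0" by (simp_all only: ring_distribs) argo+
  then have "d q = 0" "c q = 0" using p(4) r(4) by simp_all
  then have "g1 q = 0" using cd(1)[OF q] by simp
  then show False using g1_nonzero[OF q] by blast
qed

end

section \<open>Feedback equivalence\<close>

theorem corollary2:
  fixes T :: "'m topology"
    and A :: "('m, real^4) atlas"
    and g0 g1 f0 f1 f2 :: "'m vfield"
  assumes "smooth_manifold T A"
    and "smooth_vf A g0" and "smooth_vf A g1"
    and "\<And>q. q \<in> points A \<Longrightarrow>
           dim (span {g1 q, lie A g1 g0 q, lie A g1 (lie A g1 g0) q, lie A g0 (lie A g1 g0) q}) = 4"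
    and "control_affine2 A f0 f1 f2"
    and "is_reduction A f0 f1 f2 g0 g1"
  shows "feedback_equivalent A f0 f1 f2 g0 g1 (lie A g0 g1)"
proof -
  have g1_nz: "g1 q \<noteq> 0" if "q \<in> points A" for q
    using independent_pair_of_dim4(1)[OF assms(4)[OF that]] .
  interpret reduced_system T A f1 f2 f0 g0 g1
    by unfold_locales
      (use assms g1_nz control_affine2_indep[OF assms(5)] in \<open>auto simp: control_affine2_def is_reduction_def\<close>)
  let ?M = "lie A g0 g1"
  have M: "smooth_vf A ?M" using g0 g1 by (rule smooth_vf_lie)
  have M_section: "?M q \<in> span {f1 q, f2 q}" if "q \<in> points A" for q
    using that by (intro bracket_section) simp_all
  have M_notin: "?M q \<notin> span {g1 q}" if "q \<in> points A" for q
    using independent_pair_of_dim4(2)[OF assms(4)[OF that]] lie_swap[of g1 g0 q] span_neg[of "?M q"] by auto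
  have sub: "span {g1 q, ?M q} \<subseteq> span {f1 q, f2 q}" if "q \<in> points A" for q
    using g1_section[OF that] M_section[OF that] by (intro span_minimal subspace_span) simp
  obtain a b where ab: "\<And>x. x \<in> points A \<Longrightarrow> g0 x + (-1) *\<^sub>R f0 x = a x *\<^sub>R f1 x + b x *\<^sub>R f2 x"
      "\<And>x. x \<in> points A \<Longrightarrow> smooth_at A a x" "\<And>x. x \<in> points A \<Longrightarrow> smooth_at A b x"
    using section_coefficients[OF smooth_drift_difference drift_section] by blast
  obtain c d where cd: "\<And>x. x \<in> points A \<Longrightarrow> g1 x = c x *\<^sub>R f1 x + d x *\<^sub>R f2 x"
      "\<And>x. x \<in> points A \<Longrightarrow> smooth_at A c x" "\<And>x. x \<in> points A \<Longrightarrow> smooth_at A d x"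
    using section_coefficients[OF g1 g1_section] by blast
  obtain k l where kl: "\<And>x. x \<in> points A \<Longrightarrow> ?M x = k x *\<^sub>R f1 x + l x *\<^sub>R f2 x"
      "\<And>x. x \<in> points A \<Longrightarrow> smooth_at A k x" "\<And>x. x \<in> points A \<Longrightarrow> smooth_at A l x"
    using section_coefficients[OF M M_section] by blast
  have "control_affine2 A g0 g1 ?M"
    unfolding control_affine2_def
  proof (intro conjI ballI g0 g1 M)
    fix q assume q: "q \<in> points A"
    have g0_notin: "g0 q \<notin> span {f1 q, f2 q}"
    proof
      assume "g0 q \<in> span {f1 q, f2 q}"
      from span_diff[OF this drift_section[OF q]] have "f0 q \<in> span {f1 q, f2 q}" by simp
      then show False using control_affine2_indep(3)[OF assms(5) q] by blast
    qed
    have "independent {?M q, g1 q}"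
      using M_notin[OF q] g1_nz[OF q] by (intro independent_insertI) (simp_all add: independent_empty)
    moreover have "g0 q \<notin> span {?M q, g1 q}"
      using g0_notin sub[OF q] by (auto simp: insert_commute)
    ultimately have "independent {g0 q, ?M q, g1 q}"
      by (rule independent_insertI[rotated])
    then show "independent {g0 q, g1 q, ?M q}" by (simp add: insert_commute)
    show "distinct [g0 q, g1 q, ?M q]"
      using g0_notin g1_section[OF q] M_section[OF q] M_notin[OF q] span_base[of "g1 q" "{g1 q}"]
      by auto
  qed
  \<comment> \<open>The columns of \<open>B x\<close> are the coordinates of \<open>g1 x\<close> and
    \<open>[g0, g1] x\<close> in the frame \<open>f1 x\<close>, \<open>f2 x\<close>; below,
    \<open>u x\<close> holds those of \<open>g0 x - f0 x\<close>. Writing both as combinations of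
    constant matrices and vectors lets smoothness follow from that of the coefficients.\<close>
  moreover define B :: "'m \<Rightarrow> real^2^2" where "B x = c x *\<^sub>R vector [vector [1, 0], 0] + d x *\<^sub>R vector [0, vector [1, 0]]
      + (k x *\<^sub>R vector [vector [0, 1], 0] + l x *\<^sub>R vector [0, vector [0, 1]])" for x
  define u :: "'m \<Rightarrow> real^2" where "u x = a x *\<^sub>R vector [1, 0] + b x *\<^sub>R vector [0, 1]" for x
  have B_nth: "B x $ 1 $ 1 = c x" "B x $ 1 $ 2 = k x" "B x $ 2 $ 1 = d x" "B x $ 2 $ 2 = l x" for x
    by (simp_all add: B_def)
  have u_nth: "u x $ 1 = a x" "u x $ 2 = b x" for x by (simp_all add: u_def)
  have "smooth_at A B q \<and> smooth_at A u q \<and> invertible (B q) \<and>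
      (\<forall>w. let v = B q *v w + u q in f0 q + (v $ 1) *\<^sub>R f1 q + (v $ 2) *\<^sub>R f2 q
           = g0 q + (w $ 1) *\<^sub>R g1 q + (w $ 2) *\<^sub>R ?M q)" if q: "q \<in> points A" for q
  proof (intro conjI allI)
    show "smooth_at A B q"
      unfolding B_def by (intro smooth_at_add smooth_at_scaleR smooth_at_const cd(2,3) kl(2,3) q)
    show "smooth_at A u q"
      unfolding u_def by (intro smooth_at_add smooth_at_scaleR smooth_at_const ab(2,3) q)
    \<comment> \<open>A zero determinant makes the columns proportional. Since
      \<open>g1 q \<noteq> 0\<close>, one of \<open>c q\<close>, \<open>d q\<close> is nonzero, so
      \<open>[g0, g1]\<close> would be a multiple of \<open>g1\<close> at \<open>q\<close>, which
      the dimension assumption excludes.\<close>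
    have "det (B q) \<noteq> 0"
    proof
      assume "det (B q) = 0"
      then have det: "c q * l q = k q * d q" by (simp add: det_2 B_nth)
      have "\<exists>r. ?M q = r *\<^sub>R g1 q"
      proof (cases "c q = 0")
        case True
        then have "d q \<noteq> 0" using cd(1)[OF q] g1_nz[OF q] by auto
        moreover from this True have "k q = 0" using det by simp
        ultimately have "?M q = (l q / d q) *\<^sub>R g1 q"
          using True by (simp add: cd(1)[OF q] kl(1)[OF q])
        then show ?thesis ..
      next
        case False
        then have "l q = k q * d q / c q" using det by (simp add: field_simps)
        then have "?M q = (k q / c q) *\<^sub>R g1 q"
          using False by (simp add: cd(1)[OF q] kl(1)[OF q] scaleR_add_right)
        then show ?thesis ..
      qed
      then show False
        using M_notin[OF q] by (metis insertI1 span_base span_scale)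
    qed
    then show "invertible (B q)" by (simp add: invertible_det_nz)
    fix w
    have f0_eq: "g0 q = f0 q + (a q *\<^sub>R f1 q + b q *\<^sub>R f2 q)"
      using ab(1)[OF q] by (metis add.commute diff_conv_add_uminus diff_eq_eq scaleR_minus1_left)
    show "let v = B q *v w + u q in f0 q + (v $ 1) *\<^sub>R f1 q + (v $ 2) *\<^sub>R f2 q
           = g0 q + (w $ 1) *\<^sub>R g1 q + (w $ 2) *\<^sub>R ?M q"
      unfolding f0_eq cd(1)[OF q] kl(1)[OF q] Let_def
      by (rule ext) (simp add: matrix_vector_mult_def sum_2 B_nth u_nth algebra_simps)
  qed
  ultimately show ?thesis
    using assms(5) unfolding feedback_equivalent_def by blast
qed

end
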